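(* Assume $P\in[0,1)$ and $\lim_{x\uparrow 1/P}F(x)=\infty$, and assume that for every $s$ the function $\gamma\mapsto D_F^R(s,s-\gamma\sqrt{s})$ is monotonic on $(\gamma_P,\sqrt{s}]$. Let $\varepsilon>0$ be fixed. For $s$ sufficiently large let $\gamma_{s,F}^R(\varepsilon)$ be the $\gamma\in(0,\sqrt{s})$ such that, with $\lambda=s-\gamma\sqrt{s}$ and $\Omega$ the solution (with $\lambda+\Omega\in(0,\lambda_P)$) of $\Omega=(\lambda+\Omega)D_F^R(s,\lambda+\Omega)$, $$\sqrt{s}\,D_F^R(s,\lambda+\Omega)=\varepsilon .$$ Then, as $s\to\infty$, $$\gamma_{s,F}^R(\varepsilon)=\varepsilon+\delta_\infty(\varepsilon)+\frac{1}{\sqrt{s}}\,\theta_{\infty,F}^R(\varepsilon)+O(s^{-1}),$$ with $$\theta_{\infty,F}^R(\varepsilon)=-\delta_\infty(\varepsilon)\,\varepsilon-\frac{h_{\infty,F}^R(\delta_\infty(\varepsilon))}{g_\infty'(\delta_\infty(\varepsilon))}.$$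
   Context: $\Phi$ and $\varphi$ are the standard normal distribution function and density. $s\ge1$ is an integer (number of servers) and $(p_k)_{k\ge s}$ is a sequence in $[0,1]$ (admission policy). The numbers $p_{s+n}$, $n\ge 0$, do not depend on $s$ (i.e. $p_{s+n}=q_n$ for a fixed sequence $(q_n)_{n\ge0}$ in $[0,1]$), so that the power series $F(x)=\sum_{n=0}^{\infty}p_s\cdots p_{s+n}\,x^{n+1}$ and the number $P=\limsup_{n\to\infty}(p_s\cdots p_{s+n})^{1/(n+1)}\in[0,1]$ do not depend on $s$. The radius of convergence of $F$ is $1/P$ ($=\infty$ if $P=0$). Put $\lambda_P=s/P$ ($=\infty$ if $P=0$) and $\gamma_P=-\frac{1-P}{P}\sqrt{s}$ ($=-\infty$ if $P=0$). The Erlang B function is $B(s,\lambda)=\dfrac{\lambda^s/s!}{\sum_{k=0}^s\lambda^k/k!}$. For $0<\lambda<\lambda_P$ define $$D_F^R(s,\lambda)=\frac{1+(1-s/\lambda)F(\lambda/s)}{B(s,\lambda)^{-1}+F(\lambda/s)},\qquad D_F^R(s,0)=0.$$ Under the hypotheses on $P$ and $F$, the equation for $\Omega$ has exactly one solution when $\lambda\in(0,s)$. For $\gamma\in\mathbb{R}$, $g_\infty(\gamma)=\varphi(\gamma)/\Phi(\gamma)$, which decreases strictly from $+\infty$ to $0$ on $\mathbb{R}$; $\delta_\infty(\varepsilon)$ is the unique real solution $\delta$ of $g_\infty(\delta)=\varepsilon$. Further, $$h_\infty(\gamma)=-\tfrac13\big(\gamma^3+(\gamma^2+2)g_\infty(\gamma)\big)g_\infty(\gamma),\qquad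 h_{\infty,F}^R(\gamma)=h_\infty(\gamma)-(\gamma+g_\infty(\gamma))g_\infty(\gamma)F(1).$$ *)

theory Defs
  imports "HOL-Probability.Probability" "HOL-Library.Landau_Symbols"
begin

text \<open>
  The admission policy is given by its shifted sequence \<open>q\<close>: with \<open>s\<close> servers, \<open>p (s + n) = q n\<close>.
  Hence \<open>p s * \<dots> * p (s + n)\<close> is the product of \<open>q 0, \<dots>, q n\<close>.
\<close>

definition adm_F :: "(nat \<Rightarrow> real) \<Rightarrow> real \<Rightarrow> real" where
  "adm_F q x = (\<Sum>n. (\<Prod>i\<le>n. q i) * x ^ (n + 1))"

text \<open>For \<open>q\<close> with values in \<open>[0,1]\<close> the limsup lies in \<open>[0,1]\<close>, so taking its real part loses nothing.\<close>

definition adm_P :: "(nat \<Rightarrow> real) \<Rightarrow> real" where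
  "adm_P q = real_of_ereal (limsup (\<lambda>n. ereal (root (n + 1) (\<Prod>i\<le>n. q i))))"

definition lambda_P :: "(nat \<Rightarrow> real) \<Rightarrow> nat \<Rightarrow> ereal" where
  "lambda_P q s = (if adm_P q = 0 then \<infinity> else ereal (real s / adm_P q))"

definition gamma_P :: "(nat \<Rightarrow> real) \<Rightarrow> nat \<Rightarrow> ereal" where
  "gamma_P q s =
    (if adm_P q = 0 then - \<infinity> else ereal (- ((1 - adm_P q) / adm_P q) * sqrt (real s)))"

text \<open>\<open>F(x) \<rightarrow> \<infinity>\<close> as \<open>x\<close> increases to \<open>1/P\<close>, where \<open>1/P\<close> means \<open>\<infinity>\<close> if \<open>P = 0\<close>.\<close>

definition F_diverges :: "(nat \<Rightarrow> real) \<Rightarrow> bool" where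
  "F_diverges q \<longleftrightarrow>
    filterlim (adm_F q) at_top (if adm_P q = 0 then at_top else at_left (1 / adm_P q))"

definition erlang_B :: "nat \<Rightarrow> real \<Rightarrow> real" where
  "erlang_B s l = (l ^ s / fact s) / (\<Sum>k\<le>s. l ^ k / fact k)"

text \<open>Meaningful for \<open>0 \<le> l < lambda_P q s\<close> only; all uses are guarded by this range.\<close>

definition D_R :: "(nat \<Rightarrow> real) \<Rightarrow> nat \<Rightarrow> real \<Rightarrow> real" where
  "D_R q s l =
    (if l = 0 then 0
     else (1 + (1 - real s / l) * adm_F q (l / real s)) /
          (inverse (erlang_B s l) + adm_F q (l / real s)))"

definition solves_Omega :: "(nat \<Rightarrow> real) \<Rightarrow> nat \<Rightarrow> real \<Rightarrow> real \<Rightarrow> bool" where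
  "solves_Omega q s l \<Omega> \<longleftrightarrow>
    0 < l + \<Omega> \<and> ereal (l + \<Omega>) < lambda_P q s \<and> \<Omega> = (l + \<Omega>) * D_R q s (l + \<Omega>)"

definition Omega_R :: "(nat \<Rightarrow> real) \<Rightarrow> nat \<Rightarrow> real \<Rightarrow> real" where
  "Omega_R q s l = (THE \<Omega>. solves_Omega q s l \<Omega>)"

text \<open>The conjunct with the unique existence quantifier makes \<open>Omega_R\<close> well-defined wherever it is used.\<close>

definition is_gamma_R :: "(nat \<Rightarrow> real) \<Rightarrow> real \<Rightarrow> nat \<Rightarrow> real \<Rightarrow> bool" where
  "is_gamma_R q \<epsilon> s \<gamma> \<longleftrightarrow>
    0 < \<gamma> \<and> \<gamma> < sqrt (real s) \<and>
    (let l = real s - \<gamma> * sqrt (real s) in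
       (\<exists>!\<Omega>. solves_Omega q s l \<Omega>) \<and>
       sqrt (real s) * D_R q s (l + Omega_R q s l) = \<epsilon>)"

definition gamma_R :: "(nat \<Rightarrow> real) \<Rightarrow> real \<Rightarrow> nat \<Rightarrow> real" where
  "gamma_R q \<epsilon> s = (THE \<gamma>. is_gamma_R q \<epsilon> s \<gamma>)"

definition g_inf :: "real \<Rightarrow> real" where
  "g_inf \<gamma> = std_normal_density \<gamma> / cdf std_normal_distribution \<gamma>"

definition delta_inf :: "real \<Rightarrow> real" where
  "delta_inf \<epsilon> = (THE \<delta>. g_inf \<delta> = \<epsilon>)"

definition h_inf :: "real \<Rightarrow> real" where
  "h_inf \<gamma> = - (1 / 3) * (\<gamma> ^ 3 + (\<gamma>\<^sup>2 + 2) * g_inf \<gamma>) * g_inf \<gamma>"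

definition h_inf_R :: "(nat \<Rightarrow> real) \<Rightarrow> real \<Rightarrow> real" where
  "h_inf_R q \<gamma> = h_inf \<gamma> - (\<gamma> + g_inf \<gamma>) * g_inf \<gamma> * adm_F q 1"

definition theta_inf_R :: "(nat \<Rightarrow> real) \<Rightarrow> real \<Rightarrow> real" where
  "theta_inf_R q \<epsilon> =
    - delta_inf \<epsilon> * \<epsilon> - h_inf_R q (delta_inf \<epsilon>) / deriv g_inf (delta_inf \<epsilon>)"

end

theory Submission
  imports Defs "HOL-Complex_Analysis.Complex_Analysis"
begin

text \<open>
  Write \<open>n = sqrt s\<close> and parametrise the total load as \<open>\<mu> = \<lambda> + \<Omega> = s - \<delta> n\<close>. The equation for \<open>\<Omega>\<close> says
  \<open>\<lambda> = \<mu> (1 - D(\<mu>))\<close>. Together with \<open>n D(\<mu>) = \<epsilon>\<close> it gives \<open>\<lambda> = \<mu> (1 - \<epsilon> / n)\<close>, that is,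
  \<open>\<gamma> = \<delta> + \<epsilon> - \<delta> \<epsilon> / n\<close>. Hence everything reduces to the root \<open>\<delta>\<close> of the single equation
  \<open>n D(s - \<delta> n) = \<epsilon>\<close>, and the term \<open>- \<delta> \<epsilon> / n\<close> contributes the first summand of \<open>\<theta>\<close>.

  For the expansion of the root, the equation is written in terms of the reciprocal Erlang B function,
  which is a Laplace transform: with \<open>m = n - \<delta>\<close>,
  \<open>1 / (n B(s, n m)) = \<integral>\<^sub>0\<^sup>\<infinity> exp (n\<^sup>2 ln (1 + v / m) - n v) dv\<close>. The exponent is \<open>\<delta> v - v\<^sup>2 / 2\<close> plus a
  cubic polynomial divided by \<open>m\<close> plus \<open>O(m\<^sup>-\<^sup>2)\<close>, and it stays below a constant minus \<open>v\<close>; so the integral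
  equals \<open>\<Phi>(\<delta>) / \<phi>(\<delta>) = 1 / g\<^sub>\<infinity>(\<delta>)\<close> plus an explicit \<open>1 / m\<close> correction plus \<open>O(m\<^sup>-\<^sup>2)\<close>, uniformly
  for bounded \<open>\<delta>\<close> (\<open>erlang_B_expansion\<close>). Since \<open>P < 1\<close>, the series \<open>F\<close> is differentiable at \<open>1\<close>, and the
  whole equation becomes \<open>A (\<delta> - \<delta>\<^sub>0) + b / n + O((1 / n + \<bar>\<delta> - \<delta>\<^sub>0\<bar>)\<^sup>2) = 0\<close> with \<open>A > 0\<close> and
  \<open>\<delta>\<^sub>0 = \<delta>\<^sub>\<infinity>(\<epsilon>)\<close> (\<open>blocking_defect_expansion\<close>). Changing sign at \<open>\<delta>\<^sub>0 - b / (A n) \<plusminus> K / n\<^sup>2\<close>, it has a root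
  within \<open>K / n\<^sup>2\<close> of \<open>\<delta>\<^sub>0 - b / (A n)\<close> (\<open>perturbed_linear_root\<close>), and \<open>- b / A\<close> is the second summand of \<open>\<theta>\<close>.

  Two uniqueness statements make this root the one that defines \<open>\<gamma>\<close>. First, \<open>\<mu> \<mapsto> \<mu> (1 - D(\<mu>))\<close> is strictly
  increasing because it is the mean of \<open>min k s\<close> under weights proportional to \<open>w\<^sub>k \<mu>\<^sup>k\<close>; so \<open>\<Omega>\<close> is unique
  (\<open>throughput_less\<close>). Second, \<open>D\<close> takes the value \<open>\<epsilon> / n\<close> only once: by monotonicity it would otherwise be
  constant on an interval, and analytic continuation of that identity to \<open>\<mu> = 0\<close> gives a contradiction
  (\<open>D_R_not_constant\<close>).
\<close>

section \<open>The power series of the admission policy\<close>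

text \<open>
  The coefficients are taken in an arbitrary normed field because the same series is needed over the reals and,
  for analytic continuation, over the complex numbers. The constant term is \<open>0\<close>, as \<open>F\<close> starts with \<open>x\<^sup>1\<close>.
\<close>

definition adm_fps :: "(nat \<Rightarrow> real) \<Rightarrow> 'a :: {banach, real_normed_field} fps" where
  "adm_fps q = Abs_fps (\<lambda>n. case n of 0 \<Rightarrow> 0 | Suc k \<Rightarrow> of_real (\<Prod>i\<le>k. q i))"

locale admission_policy =
  fixes q :: "nat \<Rightarrow> real"
  assumes q_range: "0 \<le> q n \<and> q n \<le> 1"
begin

lemma prod_q_range: "0 \<le> (\<Prod>i\<le>n. q i)" "(\<Prod>i\<le>n. q i) \<le> 1"
  using q_range by (auto intro!: prod_nonneg prod_le_1)

lemma fps_conv_radius_adm_fps: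
  "fps_conv_radius (adm_fps q :: 'a :: {banach, real_normed_field} fps) = 
    (if adm_P q = 0 then \<infinity> else ereal (1 / adm_P q))"
proof -
  let ?a = "\<lambda>n. ereal (root (n + 1) (\<Prod>i\<le>n. q i))"
  let ?u = "\<lambda>n. ereal (root n (norm (fps_nth (adm_fps q :: 'a fps) n)))"
  have "limsup ?u = limsup (\<lambda>n. ?u (n + 1))"
    by (rule limsup_shift[symmetric])
  also have "(\<lambda>n. ?u (n + 1)) = ?a"
  proof
    fix n
    have "fps_nth (adm_fps q :: 'a fps) (n + 1) = of_real (\<Prod>i\<le>n. q i)"
      by (simp add: adm_fps_def)
    hence "norm (fps_nth (adm_fps q :: 'a fps) (n + 1)) = (\<Prod>i\<le>n. q i)"
      using prod_q_range(1)[of n] by (simp only: norm_of_real abs_of_nonneg)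
    thus "?u (n + 1) = ?a n" by simp
  qed
  finally have L: "limsup ?u = limsup ?a" .
  have "limsup ?a \<le> 1"
    using prod_q_range by (intro Limsup_bounded always_eventually) 
      (auto simp: one_ereal_def simp del: of_nat_Suc real_root_Suc_0)
  moreover have "0 \<le> limsup ?a"
    using prod_q_range by (intro le_Limsup always_eventually) 
      (auto simp: zero_ereal_def simp del: of_nat_Suc real_root_Suc_0 intro!: real_root_ge_zero)
  ultimately obtain p where p: "limsup ?a = ereal p"
    by (cases "limsup ?a") auto
  hence "adm_P q = p" by (simp add: adm_P_def)
  moreover have "fps_conv_radius (adm_fps q :: 'a fps) = inverse (ereal p)"
    using L p by (simp add: fps_conv_radius_def conv_radius_def)
  ultimately show ?thesis by (auto simp: inverse_eq_divide zero_ereal_def)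
qed

abbreviation radius :: ereal where
  "radius \<equiv> fps_conv_radius (adm_fps q :: real fps)"

lemma adm_F_eq_eval_fps:
  assumes "ereal \<bar>x\<bar> < radius"
  shows "adm_F q x = eval_fps (adm_fps q) x"
proof -
  have "summable (\<lambda>n. fps_nth (adm_fps q) n * x ^ n)"
    using assms by (intro summable_fps) auto
  hence "eval_fps (adm_fps q) x = (\<Sum>n. fps_nth (adm_fps q) (Suc n) * x ^ Suc n)"
    unfolding eval_fps_def by (subst suminf_split_head) (auto simp: adm_fps_def)
  thus ?thesis by (simp add: adm_F_def adm_fps_def)
qed

lemma eval_adm_fps_of_real:
  assumes "ereal \<bar>x\<bar> < radius"
  shows "eval_fps (adm_fps q) (of_real x) = complex_of_real (adm_F q x)"
proof -
  have "(\<lambda>n. fps_nth (adm_fps q) n * x ^ n) sums eval_fps (adm_fps q) x"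
    using assms by (intro sums_eval_fps) auto
  hence "(\<lambda>n. complex_of_real (fps_nth (adm_fps q) n * x ^ n)) sums 
      complex_of_real (eval_fps (adm_fps q) x)"
    by (rule sums_of_real)
  moreover have "(\<lambda>n. complex_of_real (fps_nth (adm_fps q) n * x ^ n)) = 
      (\<lambda>n. fps_nth (adm_fps q) n * complex_of_real x ^ n)"
    by (auto simp: adm_fps_def split: nat.splits)
  ultimately show ?thesis
    using assms by (simp add: adm_F_eq_eval_fps eval_fps_def sums_iff)
qed

lemma less_radius_trans: "\<bar>x\<bar> \<le> \<bar>y\<bar> \<Longrightarrow> ereal \<bar>y\<bar> < radius \<Longrightarrow> ereal \<bar>x\<bar> < radius"
  by (meson ereal_less_eq(3) le_less_trans)

lemma adm_F_DERIV:
  assumes "ereal \<bar>x\<bar> < radius"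
  shows "(adm_F q has_real_derivative eval_fps (fps_deriv (adm_fps q)) x) (at x)"
proof -
  have "(eval_fps (adm_fps q) has_real_derivative eval_fps (fps_deriv (adm_fps q)) x) (at x)"
    using assms by (intro has_field_derivative_eval_fps) auto
  moreover have "eventually (\<lambda>y. y \<in> eball 0 radius) (nhds x)"
    using assms by (intro eventually_nhds_in_open) (auto simp: in_eball_iff)
  hence "eventually (\<lambda>y. adm_F q y = eval_fps (adm_fps q) y) (nhds x)"
    by eventually_elim (auto simp: in_eball_iff adm_F_eq_eval_fps)
  ultimately show ?thesis
    by (subst DERIV_cong_ev[OF refl _ refl])
qed

lemma adm_F_mono:
  assumes "0 \<le> x" "x \<le> y" "ereal y < radius"
  shows "adm_F q x \<le> adm_F q y"
proof -
  have "(\<Sum>n. fps_nth (adm_fps q) n * x ^ n) \<le> (\<Sum>n. fps_nth (adm_fps q) n * y ^ n)"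
  proof (rule suminf_le)
    show "summable (\<lambda>n. fps_nth (adm_fps q) n * x ^ n)" "summable (\<lambda>n. fps_nth (adm_fps q) n * y ^ n)"
      using assms less_radius_trans[of x y] by (auto intro!: summable_fps)
    show "fps_nth (adm_fps q) n * x ^ n \<le> fps_nth (adm_fps q) n * y ^ n" for n
      using assms prod_q_range(1)
      by (auto simp: adm_fps_def split: nat.splits intro!: mult_left_mono mult_mono power_mono)
  qed
  thus ?thesis
    using assms less_radius_trans[of x y] by (simp add: adm_F_eq_eval_fps eval_fps_def)
qed

lemma adm_F_0 [simp]: "adm_F q 0 = 0"
  by (simp add: adm_F_def)

lemma adm_F_nonneg: "0 \<le> x \<Longrightarrow> ereal x < radius \<Longrightarrow> 0 \<le> adm_F q x"
  using adm_F_mono[of 0 x] by simp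

lemma less_lambda_P_iff:
  assumes "s \<ge> 1"
  shows "ereal l < lambda_P q s \<longleftrightarrow> ereal (l / real s) < radius"
proof -
  have "0 \<le> adm_P q"
  proof (rule ccontr)
    assume "\<not> 0 \<le> adm_P q"
    hence "radius < 0"
      by (simp add: fps_conv_radius_adm_fps zero_ereal_def[symmetric] divide_less_0_iff)
    moreover have "radius \<ge> 0"
      by (simp add: fps_conv_radius_def conv_radius_nonneg)
    ultimately show False by simp
  qed
  with assms show ?thesis
    by (auto simp: lambda_P_def fps_conv_radius_adm_fps field_simps)
qed

end

section \<open>Throughput and injectivity of the blocking probability\<close>

context admission_policy
begin

text \<open>
  State \<open>k\<close> of the queue has the stationary weight \<open>\<mu>\<^sup>k / k!\<close> for \<open>k \<le> s\<close> and
  \<open>\<mu>\<^sup>s / s! * (q 0 \<cdots> q j) (\<mu> / s)\<^bsup>j+1\<^esup>\<close> for \<open>k = s + j + 1\<close>; this is the sum of all weights.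
\<close>

definition mass :: "nat \<Rightarrow> real \<Rightarrow> real" where
  "mass s \<mu> = (\<Sum>k\<le>s. \<mu> ^ k / fact k) + \<mu> ^ s / fact s * adm_F q (\<mu> / s)"

lemma mass_pos:
  assumes "0 < \<mu>" "ereal (\<mu> / s) < radius"
  shows "0 < mass s \<mu>"
proof -
  have "0 < (\<Sum>k\<le>s. \<mu> ^ k / fact k)" using assms by (intro sum_pos) auto
  moreover have "0 \<le> adm_F q (\<mu> / s)" using assms by (intro adm_F_nonneg) auto
  ultimately show ?thesis
    using assms(1) unfolding mass_def by (intro add_pos_nonneg) auto
qed

lemma D_R_eq:
  assumes "0 < \<mu>"
  shows "D_R q s \<mu> = \<mu> ^ s / fact s * (1 + (1 - s / \<mu>) * adm_F q (\<mu> / s)) / mass s \<mu>"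
proof -
  define w where "w = \<mu> ^ s / fact s"
  have w: "w > 0" using assms by (simp add: w_def)
  have "inverse (erlang_B s \<mu>) + adm_F q (\<mu> / s) = mass s \<mu> / w"
    unfolding erlang_B_def mass_def w_def[symmetric] using w by (simp add: field_simps)
  thus ?thesis using assms w by (simp add: D_R_def w_def[symmetric])
qed

text \<open>
  Both sides are the total mass times the mean number of busy servers: accepted arrivals balance departures,
  and all \<open>s\<close> servers are busy in the states that \<open>F\<close> accounts for.
\<close>

lemma throughput:
  assumes "0 < \<mu>" "ereal (\<mu> / s) < radius" "s \<ge> 1"
  shows "\<mu> * (1 - D_R q s \<mu>) * mass s \<mu> = 
    (\<Sum>k\<le>s. k * (\<mu> ^ k / fact k)) + s * (\<mu> ^ s / fact s * adm_F q (\<mu> / s))"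
proof -
  define w F S where "w = \<mu> ^ s / fact s" and "F = adm_F q (\<mu> / s)" and "S = (\<Sum>k\<le>s. \<mu> ^ k / fact k)"
  have m: "mass s \<mu> > 0" using mass_pos assms by auto
  have mS: "mass s \<mu> = S + w * F" by (simp add: mass_def w_def F_def S_def)
  obtain r where r: "s = Suc r" using assms(3) by (cases s) auto
  have "(\<Sum>k\<le>s. k * (\<mu> ^ k / fact k)) = (\<Sum>k\<le>r. \<mu> * (\<mu> ^ k / fact k))"
    unfolding r by (subst sum.atMost_Suc_shift) (simp add: divide_simps del: of_nat_Suc)
  also have "\<dots> = \<mu> * (S - w)"
    unfolding S_def w_def r by (simp add: sum_distrib_left)
  finally have *: "(\<Sum>k\<le>s. k * (\<mu> ^ k / fact k)) = \<mu> * (S - w)" .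
  have "\<mu> * (1 - D_R q s \<mu>) * mass s \<mu> = \<mu> * (mass s \<mu> - w * (1 + (1 - s / \<mu>) * F))"
    using m assms(1) by (simp add: D_R_eq w_def[symmetric] F_def[symmetric] field_simps)
  also have "\<dots> = \<mu> * (S - w) + s * (w * F)"
    using assms(1) unfolding mS by (simp add: field_simps)
  finally show ?thesis unfolding * by (simp add: w_def F_def)
qed

lemma throughput_bounds:
  assumes "0 < \<mu>" "ereal (\<mu> / s) < radius" "s \<ge> 1"
  shows "0 < \<mu> * (1 - D_R q s \<mu>)" "\<mu> * (1 - D_R q s \<mu>) < s"
proof -
  define w F where "w = \<mu> ^ s / fact s" and "F = adm_F q (\<mu> / s)"
  have m: "mass s \<mu> > 0" using mass_pos assms by auto
  have F: "F \<ge> 0" "w > 0" using assms by (auto simp: F_def w_def intro!: adm_F_nonneg)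
  note eq = throughput[OF assms, folded w_def F_def]
  have "0 < (\<Sum>k\<le>s. k * (\<mu> ^ k / fact k))"
    using assms by (intro sum_pos2[of _ s]) auto
  hence "0 < \<mu> * (1 - D_R q s \<mu>) * mass s \<mu>"
    unfolding eq using F by (intro add_pos_nonneg) auto
  thus "0 < \<mu> * (1 - D_R q s \<mu>)" using m zero_less_mult_pos2 by blast
  have "(\<Sum>k\<le>s. k * (\<mu> ^ k / fact k)) < (\<Sum>k\<le>s. s * (\<mu> ^ k / fact k))"
    using assms by (intro sum_strict_mono_ex1) (auto intro!: mult_right_mono divide_right_mono bexI[of _ 0])
  hence "\<mu> * (1 - D_R q s \<mu>) * mass s \<mu> < s * mass s \<mu>"
    unfolding eq unfolding mass_def w_def[symmetric] F_def[symmetric]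
    by (simp add: sum_distrib_left distrib_left)
  thus "\<mu> * (1 - D_R q s \<mu>) < s" using m by simp
qed

text \<open>
  The throughput exceeds \<open>c\<close> exactly when \<open>H \<mu> = \<Sum> (min k s - c) w\<^sub>k \<mu>\<^sup>k\<close> is positive,
  where \<open>w\<^sub>k \<mu>\<^sup>k\<close> is the weight of state \<open>k\<close>. The coefficients of \<open>H\<close>
  change sign only once, at \<open>m = \<lceil>c\<rceil>\<close>. Hence, with \<open>\<mu>\<^sub>2 = r \<mu>\<^sub>1\<close> and \<open>r > 1\<close>, the passage from \<open>\<mu>\<^sub>1\<close>
  to \<open>\<mu>\<^sub>2\<close> multiplies the nonnegative terms by at least \<open>r\<^sup>m\<close> and the negative ones by less than \<open>r\<^sup>m\<close>.
  Since the term \<open>k = 0\<close> is negative, \<open>H \<mu>\<^sub>2 > r\<^sup>m H \<mu>\<^sub>1\<close>, so \<open>H \<mu>\<^sub>1 = 0\<close> forces \<open>H \<mu>\<^sub>2 > 0\<close>.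
\<close>

lemma throughput_less:
  assumes "0 < \<mu>\<^sub>1" "\<mu>\<^sub>1 < \<mu>\<^sub>2" "ereal (\<mu>\<^sub>2 / s) < radius" "s \<ge> 1"
  shows "\<mu>\<^sub>1 * (1 - D_R q s \<mu>\<^sub>1) < \<mu>\<^sub>2 * (1 - D_R q s \<mu>\<^sub>2)"
proof -
  have rad1: "ereal (\<mu>\<^sub>1 / s) < radius"
    using assms less_radius_trans[of "\<mu>\<^sub>1 / s" "\<mu>\<^sub>2 / s"] by (auto simp: divide_right_mono)
  define c where "c = \<mu>\<^sub>1 * (1 - D_R q s \<mu>\<^sub>1)"
  have c: "0 < c" "c < s"
    using throughput_bounds[OF assms(1) rad1 assms(4)] by (auto simp: c_def)
  define H where "H = (\<lambda>\<mu>. (\<Sum>k\<le>s. (k - c) * (\<mu> ^ k / fact k)) + 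
      (s - c) * (\<mu> ^ s / fact s * adm_F q (\<mu> / s)))"
  have H: "(\<mu> * (1 - D_R q s \<mu>) - c) * mass s \<mu> = H \<mu>" if "0 < \<mu>" "ereal (\<mu> / s) < radius" for \<mu>
  proof -
    have "H \<mu> = (\<Sum>k\<le>s. k * (\<mu> ^ k / fact k)) + s * (\<mu> ^ s / fact s * adm_F q (\<mu> / s)) - c * mass s \<mu>"
      by (simp add: H_def left_diff_distrib sum_subtractf mass_def distrib_left sum_distrib_left
          diff_divide_distrib)
    also have "\<dots> = (\<mu> * (1 - D_R q s \<mu>) - c) * mass s \<mu>"
      unfolding throughput[OF that assms(4), symmetric] by (simp add: left_diff_distrib)
    finally show ?thesis by simp
  qed
  define m where "m = nat \<lceil>c\<rceil>"
  have m: "m \<ge> 1" "m \<le> s" using c unfolding m_def by linarith+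
  have m_le: "k \<ge> c" if "k \<ge> m" for k :: nat
    using that c unfolding m_def by linarith
  have m_gt: "k < c" if "k < m" for k :: nat
    using that c unfolding m_def by linarith
  define r where "r = \<mu>\<^sub>2 / \<mu>\<^sub>1"
  have r: "r > 1" "\<mu>\<^sub>2 = r * \<mu>\<^sub>1" using assms by (auto simp: r_def)
  have rp: "(k - c) * r ^ m \<le> (k - c) * r ^ k" for k :: nat
  proof (cases "k \<ge> m")
    case True
    thus ?thesis using r m_le[of k] by (intro mult_left_mono power_increasing) auto
  next
    case False
    thus ?thesis using r m_gt[of k] by (intro mult_left_mono_neg power_increasing) auto
  qed
  have "H \<mu>\<^sub>1 = 0" using H[OF assms(1) rad1] by (simp add: c_def)
  hence "0 = r ^ m * H \<mu>\<^sub>1" by simp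
  also have "\<dots> = (\<Sum>k\<le>s. ((k - c) * r ^ m) * (\<mu>\<^sub>1 ^ k / fact k)) + 
      ((s - c) * r ^ m) * (\<mu>\<^sub>1 ^ s / fact s * adm_F q (\<mu>\<^sub>1 / s))"
    by (simp add: H_def distrib_left sum_distrib_left mult_ac)
  also have "\<dots> < (\<Sum>k\<le>s. ((k - c) * r ^ k) * (\<mu>\<^sub>1 ^ k / fact k)) + 
      ((s - c) * r ^ s) * (\<mu>\<^sub>1 ^ s / fact s * adm_F q (\<mu>\<^sub>2 / s))"
  proof (rule add_less_le_mono)
    show "(\<Sum>k\<le>s. ((k - c) * r ^ m) * (\<mu>\<^sub>1 ^ k / fact k)) < (\<Sum>k\<le>s. ((k - c) * r ^ k) * (\<mu>\<^sub>1 ^ k / fact k))"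
    proof (rule sum_strict_mono_ex1)
      show "\<forall>k\<in>{..s}. (k - c) * r ^ m * (\<mu>\<^sub>1 ^ k / fact k) \<le> (k - c) * r ^ k * (\<mu>\<^sub>1 ^ k / fact k)"
        using rp assms(1) by (intro ballI mult_right_mono) auto
      have "r ^ m > 1" using r m by (intro one_less_power) auto
      thus "\<exists>k\<in>{..s}. (k - c) * r ^ m * (\<mu>\<^sub>1 ^ k / fact k) < (k - c) * r ^ k * (\<mu>\<^sub>1 ^ k / fact k)"
        using c(1) by (intro bexI[of _ 0]) auto
    qed auto
    show "((s - c) * r ^ m) * (\<mu>\<^sub>1 ^ s / fact s * adm_F q (\<mu>\<^sub>1 / s)) \<le> 
        ((s - c) * r ^ s) * (\<mu>\<^sub>1 ^ s / fact s * adm_F q (\<mu>\<^sub>2 / s))"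
      using assms c r rp[of s] rad1
      by (intro mult_mono adm_F_mono mult_nonneg_nonneg adm_F_nonneg) (auto simp: divide_right_mono)
  qed
  also have "\<dots> = H \<mu>\<^sub>2"
    unfolding H_def r(2) by (simp add: power_mult_distrib mult_ac)
  finally have "H \<mu>\<^sub>2 > 0" .
  moreover have "mass s \<mu>\<^sub>2 > 0" using assms by (intro mass_pos) auto
  ultimately have "\<mu>\<^sub>2 * (1 - D_R q s \<mu>\<^sub>2) - c > 0"
    using H[of \<mu>\<^sub>2] assms zero_less_mult_pos2 by (metis less_trans)
  thus ?thesis by (simp add: c_def)
qed

lemma solves_Omega_unique:
  assumes "s \<ge> 1" "solves_Omega q s l \<Omega>\<^sub>1" "solves_Omega q s l \<Omega>\<^sub>2"
  shows "\<Omega>\<^sub>1 = \<Omega>\<^sub>2"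
proof -
  have "False" if "solves_Omega q s l a" "solves_Omega q s l b" "a < b" for a b
  proof -
    have "(l + a) * (1 - D_R q s (l + a)) < (l + b) * (1 - D_R q s (l + b))"
      using that assms(1) by (intro throughput_less) (auto simp: solves_Omega_def less_lambda_P_iff)
    moreover have "(l + a) * (1 - D_R q s (l + a)) = l" "(l + b) * (1 - D_R q s (l + b)) = l"
      using that unfolding solves_Omega_def by (simp_all add: right_diff_distrib)
    ultimately show False by simp
  qed
  thus ?thesis using assms(2,3) by (meson linorder_neqE_linordered_idom)
qed

text \<open>
  Multiplied by \<open>\<mu>\<^sup>s\<close> and by its denominator, the equation \<open>D = c\<close> becomes \<open>G = 0\<close> for a function \<open>G\<close> that is
  holomorphic on a disc around \<open>0\<close> containing the interval. If \<open>G\<close> vanished on the interval it would vanish at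
  \<open>0\<close>, but \<open>G 0 = - c s!\<close>.
\<close>

lemma D_R_not_constant:
  assumes "s \<ge> 1" "0 < a" "a < b" "ereal (b / s) < radius" "c \<noteq> 0"
    and const: "\<And>\<mu>. a \<le> \<mu> \<Longrightarrow> \<mu> \<le> b \<Longrightarrow> D_R q s \<mu> = c"
  shows False
proof -
  define \<phi> where "\<phi> = eval_fps (adm_fps q :: complex fps)"
  define G where "G = (\<lambda>z. z ^ s + (z - of_nat s) * z ^ (s - 1) * \<phi> (z / of_nat s) - 
     of_real c * fact s * (\<Sum>k\<le>s. z ^ k / fact k) - of_real c * z ^ s * \<phi> (z / of_nat s))"
  obtain R' where "ereal (b / s) < R'" "R' < radius" using dense[OF assms(4)] by blast
  then obtain R where R: "b / s < R" "ereal R < radius"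
    by (cases R') auto
  have crad: "fps_conv_radius (adm_fps q :: complex fps) = radius"
    by (simp only: fps_conv_radius_adm_fps)
  have inball: "(\<lambda>z. z / complex_of_nat s) ` ball 0 (R * real s) \<subseteq> eball 0 (fps_conv_radius (adm_fps q :: complex fps))"
  proof (clarsimp simp: in_eball_iff crad)
    fix z :: complex assume "norm z < R * s"
    hence "norm z / s \<le> R" using assms(1) by (simp add: field_simps)
    thus "ereal (norm (z / of_nat s)) < radius"
      using R(2) by (simp add: norm_divide) (meson ereal_less_eq(3) le_less_trans)
  qed
  have "(\<lambda>z. z / complex_of_nat s) holomorphic_on ball 0 (R * s)"
    using assms(1) by (intro holomorphic_intros) auto
  hence "(\<lambda>z. \<phi> (z / of_nat s)) holomorphic_on ball 0 (R * s)"
    using holomorphic_on_compose_gen[OF _ holomorphic_on_eval_fps[OF order_refl] inball]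
    by (simp add: o_def \<phi>_def)
  hence "G holomorphic_on ball 0 (R * s)"
    unfolding G_def by (intro holomorphic_intros) auto
  moreover have "G z = 0" if z: "z \<in> of_real ` {a..b}" for z
  proof -
    from z obtain \<mu> where \<mu>: "a \<le> \<mu>" "\<mu> \<le> b" "z = of_real \<mu>" by auto
    define F where "F = adm_F q (\<mu> / s)"
    have mu0: "\<mu> > 0" using \<mu> assms by auto
    have rad: "ereal (\<mu> / s) < radius"
      using less_radius_trans[of "\<mu> / s" "b / s"] \<mu> assms by (auto simp: divide_right_mono)
    have F: "\<phi> (z / of_nat s) = of_real F"
      using eval_adm_fps_of_real[of "\<mu> / s"] rad mu0 by (simp add: \<phi>_def \<mu> F_def)
    have "\<mu> ^ s / fact s * (1 + (1 - s / \<mu>) * F) = c * mass s \<mu>"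
      using const[OF \<mu>(1,2)] D_R_eq[OF mu0, of s] mass_pos[OF mu0 rad] by (simp add: F_def field_simps)
    hence "\<mu> ^ s * (1 + (1 - s / \<mu>) * F) = c * fact s * (\<Sum>k\<le>s. \<mu> ^ k / fact k) + c * \<mu> ^ s * F"
      by (simp add: mass_def F_def field_simps)
    moreover have "\<mu> ^ s = \<mu> * \<mu> ^ (s - 1)"
      using assms(1) by (cases s) auto
    hence "\<mu> ^ s * (1 + (1 - s / \<mu>) * F) = \<mu> ^ s + (\<mu> - s) * \<mu> ^ (s - 1) * F"
      using mu0 by (simp add: field_simps)
    ultimately have "\<mu> ^ s + (\<mu> - s) * \<mu> ^ (s - 1) * F - c * fact s * (\<Sum>k\<le>s. \<mu> ^ k / fact k) - c * \<mu> ^ s * F = 0"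
      by linarith
    hence "complex_of_real (\<mu> ^ s + (\<mu> - s) * \<mu> ^ (s - 1) * F - c * fact s * (\<Sum>k\<le>s. \<mu> ^ k / fact k) - c * \<mu> ^ s * F) = 0"
      by (simp only: of_real_0)
    thus ?thesis unfolding G_def F by (simp add: \<mu>(3))
  qed
  moreover have "complex_of_real a islimpt (of_real ` {a..b})"
  proof -
    have "a islimpt {a..b}"
      using islimpt_greaterThanLessThan1[OF assms(3)] by (rule islimpt_subset) auto
    then obtain f where f: "\<And>n::nat. f n \<in> {a..b} - {a}" "f \<longlonglongrightarrow> a"
      unfolding islimpt_sequential by blast
    show ?thesis unfolding islimpt_sequential
      using f by (intro exI[of _ "\<lambda>n. of_real (f n)"]) (auto intro!: tendsto_of_real)
  qed
  moreover have "of_real ` {a..b} \<subseteq> ball (0::complex) (R * s)" "complex_of_real a \<in> ball 0 (R * s)" "0 \<in> ball (0::complex) (R * s)"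
    using R assms by (auto simp: field_simps)
  ultimately have "G 0 = 0"
    by (intro analytic_continuation[of G "ball 0 (R * s)" "of_real ` {a..b}" "of_real a" 0]) auto
  moreover have "\<phi> 0 = 0" by (simp add: \<phi>_def eval_fps_at_0 adm_fps_def)
  moreover have "(\<Sum>k\<le>s. (0::complex) ^ k / fact k) = 1"
    by (simp add: sum.atMost_shift)
  ultimately show False using assms by (simp add: G_def power_0_left)
qed

end

section \<open>The Gaussian integrals that give \<open>1 / g\<^sub>\<infinity>\<close> and its correction\<close>

lemma set_integrable_pow_exp: "set_integrable lborel {0<..} (\<lambda>v::real. v ^ k * exp (- v))"
  and set_integral_pow_exp: "(LBINT v:{0<..}. (v::real) ^ k * exp (- v)) = fact k"
proof -
  have "has_bochner_integral lborel (\<lambda>v::real. (v ^ k * exp (- v)) * indicator {0..} v) (fact k)"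
    using nn_intergal_power_times_exp_Ici[of k]
    by (intro has_bochner_integral_nn_integral)
       (auto simp: ennreal_mult'' ennreal_indicator[symmetric] indicator_def of_nat_fact
             intro!: mult_nonneg_nonneg)
  hence "has_bochner_integral lborel (\<lambda>v::real. indicator {0<..} v *\<^sub>R (v ^ k * exp (- v))) (fact k)"
  proof (subst has_bochner_integral_cong_AE[where g = "\<lambda>v::real. (v ^ k * exp (- v)) * indicator {0..} v"])
    show "AE v in lborel. indicator {0<..} v *\<^sub>R (v ^ k * exp (- v)) = (v ^ k * exp (- v)) * indicator {0..} (v::real)"
      using AE_lborel_singleton[of "0::real"] by eventually_elim (auto simp: indicator_def)
  qed auto
  thus "set_integrable lborel {0<..} (\<lambda>v::real. v ^ k * exp (- v))"
    and "(LBINT v:{0<..}. (v::real) ^ k * exp (- v)) = fact k"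
    unfolding set_integrable_def set_lebesgue_integral_def
    by (auto intro: integrable.intros has_bochner_integral_integral_eq simp del: real_scaleR_def)
qed

lemma has_bochner_integral_pow_exp_scaled:
  assumes "0 < n"
  shows "has_bochner_integral lborel (\<lambda>v::real. indicator {0<..} v *\<^sub>R (v ^ k * exp (- n * v))) (fact k / n ^ Suc k)"
proof -
  have "has_bochner_integral lborel (\<lambda>v::real. indicator {0<..} v *\<^sub>R (v ^ k * exp (- v))) (fact k)"
    using set_integrable_pow_exp[of k] set_integral_pow_exp[of k]
    unfolding set_integrable_def set_lebesgue_integral_def has_bochner_integral_iff
    by (rule conjI)
  hence "has_bochner_integral lborel (\<lambda>v::real. indicator {0<..} (0 + n * v) *\<^sub>R ((0 + n * v) ^ k * exp (- (0 + n * v))))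
      (fact k /\<^sub>R \<bar>n\<bar>)"
    using assms by (subst (asm) lborel_has_bochner_integral_real_affine_iff[of n _ _ 0]) auto
  hence "has_bochner_integral lborel (\<lambda>v::real. (1 / n ^ k) *\<^sub>R (indicator {0<..} (0 + n * v) *\<^sub>R ((0 + n * v) ^ k * exp (- (0 + n * v)))))
      ((1 / n ^ k) *\<^sub>R (fact k /\<^sub>R \<bar>n\<bar>))"
    by (intro has_bochner_integral_scaleR_right)
  moreover have "(\<lambda>v::real. (1 / n ^ k) *\<^sub>R (indicator {0<..} (0 + n * v) *\<^sub>R ((0 + n * v) ^ k * exp (- (0 + n * v))))) 
      = (\<lambda>v::real. indicator {0<..} v *\<^sub>R (v ^ k * exp (- n * v)))"
    using assms by (auto simp: indicator_def zero_less_mult_iff power_mult_distrib fun_eq_iff)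
  moreover have "(1 / n ^ k) *\<^sub>R (fact k /\<^sub>R \<bar>n\<bar>) = fact k / n ^ Suc k"
    using assms by (simp add: field_simps)
  ultimately show ?thesis by simp
qed

lemma set_integrable_poly_exp: "set_integrable lborel {0<..} (\<lambda>v::real. (1 + v) ^ k * exp (- v))"
proof -
  have "(\<lambda>v::real. indicator {0<..} v *\<^sub>R ((1 + v) ^ k * exp (- v))) = 
      (\<lambda>v. \<Sum>j\<le>k. of_nat (k choose j) * (indicator {0<..} v *\<^sub>R (v ^ j * exp (- v))))"
    by (intro ext) (simp add: add.commute[of 1] binomial_ring sum_distrib_left sum_distrib_right mult_ac)
  moreover have "integrable lborel (\<lambda>v::real. \<Sum>j\<le>k. of_nat (k choose j) * (indicator {0<..} v *\<^sub>R (v ^ j * exp (- v))))"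
    using set_integrable_pow_exp unfolding set_integrable_def by (intro Bochner_Integration.integrable_sum integrable_mult_right)
  ultimately show ?thesis unfolding set_integrable_def by simp
qed

definition poly_exp_moment :: "nat \<Rightarrow> real" where
  "poly_exp_moment k = (LBINT v:{0<..}. (1 + v) ^ k * exp (- v))"

lemma poly_exp_moment_nonneg: "0 \<le> poly_exp_moment k"
  unfolding poly_exp_moment_def set_lebesgue_integral_def
  by (intro integral_nonneg_AE) (auto simp: indicator_def)

lemma dominated_half_line:
  fixes f :: "real \<Rightarrow> real"
  assumes meas: "f \<in> borel_measurable borel"
    and le: "\<And>v. 0 < v \<Longrightarrow> \<bar>f v\<bar> \<le> C * ((1 + v) ^ k * exp (- v))"
  shows "set_integrable lborel {0<..} f" "\<bar>LBINT v:{0<..}. f v\<bar> \<le> C * poly_exp_moment k"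
proof -
  have dom: "set_integrable lborel {0<..} (\<lambda>v. C * ((1 + v) ^ k * exp (- v)))"
    using set_integrable_poly_exp by (rule set_integrable_mult_right)
  show int: "set_integrable lborel {0<..} f"
    using le meas by (intro set_integrable_bound[OF dom]) 
      (force simp: set_borel_measurable_def)+
  have "\<bar>LBINT v:{0<..}. f v\<bar> \<le> (LBINT v:{0<..}. \<bar>f v\<bar>)"
    using set_integral_norm_bound[OF int] by simp
  also have "\<dots> \<le> (LBINT v:{0<..}. C * ((1 + v) ^ k * exp (- v)))"
    using le by (intro set_integral_mono dom set_integrable_abs int) auto
  also have "\<dots> = C * poly_exp_moment k"
    by (simp add: poly_exp_moment_def)
  finally show "\<bar>LBINT v:{0<..}. f v\<bar> \<le> C * poly_exp_moment k" .
qed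

lemma gauss_exponent_le:
  fixes \<gamma> v G :: real
  assumes "\<bar>\<gamma>\<bar> \<le> G" "0 \<le> v"
  shows "\<gamma> * v - v\<^sup>2 / 2 \<le> (G + 1)\<^sup>2 / 2 - v"
proof -
  have "\<gamma> * v \<le> G * v" using assms by (intro mult_right_mono) auto
  moreover have "0 \<le> (v - (G + 1))\<^sup>2" by simp
  ultimately show ?thesis by (simp add: power2_eq_square algebra_simps)
qed

lemma gauss_dominated:
  fixes f :: "real \<Rightarrow> real"
  assumes meas: "f \<in> borel_measurable borel"
    and le: "\<And>v. 0 < v \<Longrightarrow> \<bar>f v\<bar> \<le> C * (1 + v) ^ k"
  shows "set_integrable lborel {0<..} (\<lambda>v. f v * exp (\<gamma> * v - v\<^sup>2 / 2))"
    and "0 < v \<Longrightarrow> \<bar>f v * exp (\<gamma> * v - v\<^sup>2 / 2)\<bar> \<le> (C * exp ((\<bar>\<gamma>\<bar> + 1)\<^sup>2 / 2)) * ((1 + v) ^ k * exp (- v))"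
proof -
  let ?K = "exp ((\<bar>\<gamma>\<bar> + 1)\<^sup>2 / 2)"
  show *: "\<bar>f v * exp (\<gamma> * v - v\<^sup>2 / 2)\<bar> \<le> (C * ?K) * ((1 + v) ^ k * exp (- v))" if "0 < v" for v
  proof -
    have "exp (\<gamma> * v - v\<^sup>2 / 2) \<le> ?K * exp (- v)"
      using gauss_exponent_le[of \<gamma> "\<bar>\<gamma>\<bar>" v] that by (simp add: exp_add[symmetric])
    hence "\<bar>f v\<bar> * exp (\<gamma> * v - v\<^sup>2 / 2) \<le> (C * (1 + v) ^ k) * (?K * exp (- v))"
      using le[OF that] that by (intro mult_mono) (auto intro: order_trans[OF abs_ge_zero])
    thus ?thesis by (simp add: abs_mult mult_ac)
  qed
  have "(\<lambda>v. f v * exp (\<gamma> * v - v\<^sup>2 / 2)) \<in> borel_measurable borel"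
    using meas by measurable
  thus "set_integrable lborel {0<..} (\<lambda>v. f v * exp (\<gamma> * v - v\<^sup>2 / 2))"
    using * by (rule dominated_half_line)
qed

text \<open>
  The integrand is the derivative of \<open>u v * exp (\<gamma> v - v\<^sup>2 / 2)\<close>, which vanishes at infinity. This replaces
  explicit recurrences for the moments of the weight \<open>exp (\<gamma> v - v\<^sup>2 / 2)\<close>.
\<close>

lemma gauss_integral_by_parts:
  fixes u u' :: "real \<Rightarrow> real"
  assumes deriv: "\<And>v. (u has_real_derivative u' v) (at v)"
    and cont: "continuous_on UNIV u'"
    and le: "\<And>v. 0 < v \<Longrightarrow> \<bar>u v\<bar> \<le> C * (1 + v) ^ k" "\<And>v. 0 < v \<Longrightarrow> \<bar>u' v\<bar> \<le> C * (1 + v) ^ k"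
  shows "(LBINT v:{0<..}. (u' v + u v * (\<gamma> - v)) * exp (\<gamma> * v - v\<^sup>2 / 2)) = - u 0"
proof -
  let ?E = "\<lambda>v. exp (\<gamma> * v - v\<^sup>2 / 2)"
  let ?f = "\<lambda>v. (u' v + u v * (\<gamma> - v)) * ?E v"
  have cu: "continuous_on UNIV u"
    using deriv by (meson DERIV_isCont continuous_at_imp_continuous_on)
  have meas: "(\<lambda>v. u' v + u v * (\<gamma> - v)) \<in> borel_measurable borel"
    by (intro borel_measurable_continuous_onI continuous_intros cont cu)
  have C: "C \<ge> 0"
    using le(1)[of 1] by (smt (verit) zero_less_power zero_le_mult_iff)
  have bd: "\<bar>u' v + u v * (\<gamma> - v)\<bar> \<le> (C * (2 + \<bar>\<gamma>\<bar>)) * (1 + v) ^ (k + 1)" if "0 < v" for v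
  proof -
    have "\<bar>u v * (\<gamma> - v)\<bar> \<le> (C * (1 + v) ^ k) * ((1 + \<bar>\<gamma>\<bar>) * (1 + v))"
      unfolding abs_mult
    proof (intro mult_mono le(1) that)
      have "\<bar>\<gamma> - v\<bar> \<le> \<bar>\<gamma>\<bar> + v" using that by linarith
      also have "\<dots> \<le> (1 + \<bar>\<gamma>\<bar>) * (1 + v)" using that by (simp add: distrib_left distrib_right)
      finally show "\<bar>\<gamma> - v\<bar> \<le> (1 + \<bar>\<gamma>\<bar>) * (1 + v)" .
    qed (use C that in auto)
    moreover have "\<bar>u' v\<bar> \<le> (C * (1 + v) ^ k) * (1 + v)"
    proof -
      have "C * (1 + v) ^ k * 1 \<le> (C * (1 + v) ^ k) * (1 + v)"
        using C that by (intro mult_left_mono) auto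
      thus ?thesis using le(2)[OF that] by linarith
    qed
    moreover have "(C * (2 + \<bar>\<gamma>\<bar>)) * (1 + v) ^ (k + 1) = (C * (1 + v) ^ k) * ((1 + \<bar>\<gamma>\<bar>) * (1 + v)) + (C * (1 + v) ^ k) * (1 + v)"
      by (simp add: algebra_simps)
    ultimately show ?thesis by linarith
  qed
  have int: "set_integrable lborel {0<..} ?f"
    by (rule gauss_dominated[OF meas bd])
  have lim: "((\<lambda>v. u v * ?E v) \<longlongrightarrow> 0) at_top"
  proof (rule Lim_null_comparison)
    have "u \<in> borel_measurable borel" by (intro borel_measurable_continuous_onI cu)
    note * = gauss_dominated(2)[OF this le(1)]
    show "\<forall>\<^sub>F v in at_top. norm (u v * ?E v) \<le> (C * exp ((\<bar>\<gamma>\<bar> + 1)\<^sup>2 / 2)) * ((1 + v) ^ k * exp (- v))"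
      using eventually_gt_at_top[of 0] by eventually_elim (use * in simp)
    have "((\<lambda>v::real. (1 + v) ^ k / exp (1 + v)) \<longlongrightarrow> 0) at_top"
      by (rule filterlim_compose[OF tendsto_power_div_exp_0])
         (rule filterlim_tendsto_add_at_top[OF tendsto_const filterlim_ident])
    hence "((\<lambda>v::real. (C * exp ((\<bar>\<gamma>\<bar> + 1)\<^sup>2 / 2) * exp 1) * ((1 + v) ^ k / exp (1 + v))) \<longlongrightarrow> 0) at_top"
      by (rule tendsto_mult_right_zero)
    thus "((\<lambda>v::real. (C * exp ((\<bar>\<gamma>\<bar> + 1)\<^sup>2 / 2)) * ((1 + v) ^ k * exp (- v))) \<longlongrightarrow> 0) at_top"
      by (simp add: exp_add exp_minus field_simps)
  qed
  have ein: "einterval 0 \<infinity> = {0<..}" by (auto simp: einterval_def zero_ereal_def)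
  have "interval_lebesgue_integral lborel 0 \<infinity> ?f = 0 - u 0 * ?E 0"
  proof (rule interval_integral_FTC_integrable[where F = "\<lambda>v. u v * ?E v"])
    show "((\<lambda>v. u v * ?E v) has_vector_derivative ?f x) (at x)" for x
      unfolding has_real_derivative_iff_has_vector_derivative[symmetric]
      by (auto intro!: derivative_eq_intros deriv simp: algebra_simps)
    show "isCont ?f x" for x
      using cont cu by (auto intro!: continuous_intros simp: continuous_on_eq_continuous_at)
    show "set_integrable lborel (einterval 0 \<infinity>) ?f" using int by (simp add: ein)
    have "isCont (\<lambda>v. u v * ?E v) 0"
      using cu by (auto intro!: continuous_intros simp: continuous_on_eq_continuous_at)
    hence "((\<lambda>v. u v * ?E v) \<longlongrightarrow> u 0 * ?E 0) (at_right 0)"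
      by (auto simp: isCont_def intro: tendsto_within_subset)
    thus "(((\<lambda>v. u v * ?E v) \<circ> real_of_ereal) \<longlongrightarrow> u 0 * ?E 0) (at_right 0)"
      by (simp add: zero_ereal_def ereal_tendsto_simps)
    show "(((\<lambda>v. u v * ?E v) \<circ> real_of_ereal) \<longlongrightarrow> 0) (at_left \<infinity>)"
      using lim by (simp add: ereal_tendsto_simps)
  qed auto
  moreover have "interval_lebesgue_integral lborel 0 \<infinity> ?f = (LBINT v:{0<..}. ?f v)"
    by (simp add: interval_lebesgue_integral_def ein)
  ultimately show ?thesis by simp
qed

text \<open>
  Substituting \<open>t = \<gamma> - v\<close> shows that this is \<open>\<Phi> \<gamma> / \<phi> \<gamma>\<close>, the Mills ratio at \<open>- \<gamma>\<close>, that is, \<open>1 / g\<^sub>\<infinity> \<gamma>\<close>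
  (lemma \<open>g_inf_eq\<close>). Working with it instead of \<open>g\<^sub>\<infinity>\<close> makes positivity and monotonicity visible under the
  integral sign.
\<close>

definition mills :: "real \<Rightarrow> real" where
  "mills \<gamma> = (LBINT v:{0<..}. exp (\<gamma> * v - v\<^sup>2 / 2))"

lemma gauss_integrable_pow: "set_integrable lborel {0<..} (\<lambda>v::real. v ^ k * exp (\<gamma> * v - v\<^sup>2 / 2))"
  by (rule gauss_dominated[where C = 1 and k = k]) (auto intro!: power_mono)

lemma gauss_integrable: "set_integrable lborel {0<..} (\<lambda>v::real. exp (\<gamma> * v - v\<^sup>2 / 2))"
  using gauss_integrable_pow[of 0 \<gamma>] by simp

lemma gauss_integral_pos:
  "0 < (LBINT v:{0<..}. (v::real) ^ k * exp (\<gamma> * v - v\<^sup>2 / 2))"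
proof -
  let ?f = "\<lambda>v::real. indicator {0<..} v *\<^sub>R (v ^ k * exp (\<gamma> * v - v\<^sup>2 / 2)) :: real"
  have int: "integrable lborel ?f"
    using gauss_integrable_pow by (simp add: set_integrable_def)
  have nn: "0 \<le> ?f v" for v by (auto simp: indicator_def)
  have "integral\<^sup>L lborel ?f \<noteq> 0"
  proof
    assume "integral\<^sup>L lborel ?f = 0"
    hence "AE v in lborel. ?f v = 0"
      using integral_nonneg_eq_0_iff_AE[OF int] nn by auto
    hence "AE v in lborel. v \<notin> {0<..(1::real)}"
      by eventually_elim (auto simp: indicator_def split: if_splits)
    hence "emeasure lborel {0<..(1::real)} = 0"
      by (subst (asm) AE_iff_measurable[where N = "{0<..1}"]) auto
    thus False by simp
  qed
  moreover have "integral\<^sup>L lborel ?f \<ge> 0" using nn by (intro integral_nonneg_AE) auto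
  ultimately show ?thesis by (simp add: set_lebesgue_integral_def)
qed

lemma mills_pos: "0 < mills \<gamma>"
  using gauss_integral_pos[of 0 \<gamma>] by (simp add: mills_def)

lemma gauss_first_moment: "(LBINT v:{0<..}. v * exp (\<gamma> * v - v\<^sup>2 / 2)) = 1 + \<gamma> * mills \<gamma>"
proof -
  have "(LBINT v:{0<..}. (0 + 1 * (\<gamma> - v)) * exp (\<gamma> * v - v\<^sup>2 / 2)) = - 1"
    by (rule gauss_integral_by_parts[where C = 1 and k = 0]) auto
  moreover have "(LBINT v:{0<..}. (0 + 1 * (\<gamma> - v)) * exp (\<gamma> * v - v\<^sup>2 / 2)) = 
     (LBINT v:{0<..}. \<gamma> * exp (\<gamma> * v - v\<^sup>2 / 2)) - (LBINT v:{0<..}. v * exp (\<gamma> * v - v\<^sup>2 / 2))"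
    using gauss_integrable[of \<gamma>] gauss_integrable_pow[of 1 \<gamma>]
    by (subst set_integral_diff(2)[symmetric]) (auto simp: algebra_simps)
  ultimately show ?thesis by (simp add: mills_def)
qed

text \<open>
  The quantity \<open>1 + \<gamma> * mills \<gamma>\<close> is the derivative of \<open>mills\<close> (lemma \<open>mills_DERIV\<close>). It is positive as the first
  moment of a positive weight; this is the inequality \<open>\<gamma> + g\<^sub>\<infinity> \<gamma> > 0\<close>.
\<close>

lemma mills_deriv_pos: "0 < 1 + \<gamma> * mills \<gamma>"
  using gauss_integral_pos[of 1 \<gamma>] gauss_first_moment[of \<gamma>] by simp

text \<open>
  The coefficient of \<open>1 / \<surd>s\<close> in the expansion of \<open>1 / (\<surd>s B(s, s - \<gamma> \<surd>s))\<close>; it equals \<open>- h\<^sub>\<infinity> / g\<^sub>\<infinity>\<^sup>2\<close>.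
\<close>

definition mills_corr :: "real \<Rightarrow> real" where
  "mills_corr \<gamma> = \<gamma> ^ 3 * mills \<gamma> / 3 + (\<gamma>\<^sup>2 + 2) / 3"

lemma gauss_cubic_integrable:
  fixes \<gamma> :: real
  shows "set_integrable lborel {0<..} (\<lambda>v::real. (\<gamma>\<^sup>2 * v - \<gamma> * v\<^sup>2 + v ^ 3 / 3) * exp (\<gamma> * v - v\<^sup>2 / 2))"
proof -
  let ?E = "\<lambda>v::real. exp (\<gamma> * v - v\<^sup>2 / 2)"
  have "set_integrable lborel {0<..} (\<lambda>v::real. \<gamma>\<^sup>2 * (v ^ 1 * ?E v) - \<gamma> * (v\<^sup>2 * ?E v) + (1 / 3) * (v ^ 3 * ?E v))"
    using gauss_integrable_pow by (intro set_integral_add set_integral_diff set_integrable_mult_right)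
  thus ?thesis by (simp add: algebra_simps)
qed

text \<open>
  The polynomial \<open>p = \<gamma>\<^sup>2 v - \<gamma> v\<^sup>2 + v\<^sup>3 / 3\<close> and the constant \<open>\<gamma>\<^sup>3 / 3\<close> differ by an expression that integrates in closed form: for
  \<open>u = - (v\<^sup>2 / 3 - 2 \<gamma> v / 3 + (\<gamma>\<^sup>2 + 2) / 3)\<close> one has \<open>u' + u (\<gamma> - v) = p - \<gamma>\<^sup>3 / 3\<close>.
\<close>

lemma gauss_cubic_moment:
  "(LBINT v:{0<..}. (\<gamma>\<^sup>2 * v - \<gamma> * v\<^sup>2 + v ^ 3 / 3) * exp (\<gamma> * v - v\<^sup>2 / 2)) = mills_corr \<gamma>"
proof -
  let ?E = "\<lambda>v. exp (\<gamma> * v - v\<^sup>2 / 2)"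
  let ?u = "\<lambda>v. - (v\<^sup>2 / 3 - 2 * \<gamma> * v / 3 + (\<gamma>\<^sup>2 + 2) / 3)"
  let ?u' = "\<lambda>v. - (2 * v / 3 - 2 * \<gamma> / 3)"
  let ?p = "\<lambda>v. \<gamma>\<^sup>2 * v - \<gamma> * v\<^sup>2 + v ^ 3 / 3"
  have "(LBINT v:{0<..}. (?u' v + ?u v * (\<gamma> - v)) * ?E v) = - ?u 0"
  proof (rule gauss_integral_by_parts[where C = "2 + 2 * \<bar>\<gamma>\<bar> + \<gamma>\<^sup>2" and k = 2])
    show "(?u has_real_derivative ?u' v) (at v)" for v
      by (auto intro!: derivative_eq_intros)
    fix v :: real assume v: "0 < v"
    have le: "v \<le> (1 + v)\<^sup>2" "v\<^sup>2 \<le> (1 + v)\<^sup>2" "1 \<le> (1 + v)\<^sup>2"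
      using v by (auto simp: power2_eq_square algebra_simps)
    have a: "\<bar>\<gamma>\<bar> * v \<le> \<bar>\<gamma>\<bar> * (1 + v)\<^sup>2" "\<bar>\<gamma>\<bar> * 1 \<le> \<bar>\<gamma>\<bar> * (1 + v)\<^sup>2" "\<gamma>\<^sup>2 * 1 \<le> \<gamma>\<^sup>2 * (1 + v)\<^sup>2"
      "0 \<le> \<gamma>\<^sup>2 * (1 + v)\<^sup>2" "0 \<le> \<bar>\<gamma>\<bar> * (1 + v)\<^sup>2"
      by (intro mult_left_mono le mult_nonneg_nonneg; simp)+
    have b: "\<bar>\<gamma> * v\<bar> = \<bar>\<gamma>\<bar> * v" using v by (simp add: abs_mult)
    define X A B where "X = (1 + v)\<^sup>2" and "A = \<bar>\<gamma>\<bar> * X" and "B = \<gamma>\<^sup>2 * X"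
    have rhs: "(2 + 2 * \<bar>\<gamma>\<bar> + \<gamma>\<^sup>2) * (1 + v)\<^sup>2 = 2 * X + 2 * A + B"
      by (simp add: A_def B_def X_def algebra_simps)
    have c: "\<bar>\<gamma> * v\<bar> \<le> A" "\<bar>\<gamma>\<bar> \<le> A" "\<gamma>\<^sup>2 \<le> B" "v \<le> X" "v\<^sup>2 \<le> X" "1 \<le> X" "0 \<le> A" "0 \<le> B"
      using a b le by (auto simp: A_def B_def X_def)
    have u: "?u v = - (v\<^sup>2) / 3 + 2 / 3 * (\<gamma> * v) - \<gamma>\<^sup>2 / 3 - 2 / 3"
      by (simp add: field_simps)
    show "\<bar>?u v\<bar> \<le> (2 + 2 * \<bar>\<gamma>\<bar> + \<gamma>\<^sup>2) * (1 + v)\<^sup>2" "\<bar>?u' v\<bar> \<le> (2 + 2 * \<bar>\<gamma>\<bar> + \<gamma>\<^sup>2) * (1 + v)\<^sup>2"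
      unfolding rhs u using c v zero_le_power2[of v] zero_le_power2[of \<gamma>]
      by - linarith+
  qed (auto intro!: continuous_intros)
  also have "(\<lambda>v. (?u' v + ?u v * (\<gamma> - v)) * ?E v) = (\<lambda>v. ?p v * ?E v - \<gamma> ^ 3 / 3 * ?E v)"
    by (intro ext) (simp add: field_simps power2_eq_square power3_eq_cube)
  also have "(LBINT v:{0<..}. ?p v * ?E v - \<gamma> ^ 3 / 3 * ?E v) = 
      (LBINT v:{0<..}. ?p v * ?E v) - (LBINT v:{0<..}. \<gamma> ^ 3 / 3 * ?E v)"
  proof (rule set_integral_diff)
    show "set_integrable lborel {0<..} (\<lambda>v. ?p v * ?E v)"
      by (rule gauss_cubic_integrable)
    show "set_integrable lborel {0<..} (\<lambda>v. \<gamma> ^ 3 / 3 * ?E v)"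
      using gauss_integrable by (intro set_integrable_mult_right)
  qed
  finally show ?thesis by (simp add: mills_def mills_corr_def field_simps)
qed

lemma cdf_eq_mills: "cdf std_normal_distribution \<gamma> = std_normal_density \<gamma> * mills \<gamma>"
proof -
  have "cdf std_normal_distribution \<gamma> = (LINT x|std_normal_distribution. indicator {..\<gamma>} x)"
    by (simp add: cdf_def)
  also have "\<dots> = (LBINT x. std_normal_density x *\<^sub>R indicator {..\<gamma>} x)"
    by (subst integral_density) auto
  also have "\<dots> = (LBINT v. std_normal_density (\<gamma> + -1 * v) *\<^sub>R indicator {..\<gamma>} (\<gamma> + -1 * v))"
    by (subst lborel_integral_real_affine[of "-1" _ \<gamma>]) auto
  also have "\<dots> = (LBINT v. std_normal_density \<gamma> * (indicator {0<..} v *\<^sub>R exp (\<gamma> * v - v\<^sup>2 / 2)))"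
  proof (rule integral_cong_AE)
    show "AE v in lborel. std_normal_density (\<gamma> + -1 * v) *\<^sub>R indicator {..\<gamma>} (\<gamma> + -1 * v) = 
        std_normal_density \<gamma> * (indicator {0<..} v *\<^sub>R exp (\<gamma> * v - v\<^sup>2 / 2))"
      using AE_lborel_singleton[of 0]
      by eventually_elim 
         (auto simp: indicator_def std_normal_density_def exp_add[symmetric] power2_eq_square field_simps)
  qed auto
  also have "\<dots> = std_normal_density \<gamma> * mills \<gamma>"
    by (simp add: mills_def set_lebesgue_integral_def)
  finally show ?thesis .
qed

lemma g_inf_eq: "g_inf \<gamma> = 1 / mills \<gamma>"
  unfolding g_inf_def cdf_eq_mills using normal_density_pos[of 1 0 \<gamma>] by simp

text \<open>
  The factor \<open>max 1 (exp a)\<close>, rather than \<open>exp \<bar>a\<bar>\<close>, matters: multiplied by \<open>exp x\<close> it gives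
  \<open>max (exp x) (exp (x + a))\<close>, and in each application both entries have integrable bounds.
\<close>

lemma exp_second_order: "\<bar>exp a - 1 - a\<bar> \<le> a\<^sup>2 / 2 * max 1 (exp a)" for a :: real
proof -
  have "exp a - 1 - a \<ge> 0" using exp_ge_add_one_self[of a] by linarith
  moreover have "exp a - 1 - a \<le> a\<^sup>2 / 2 * max 1 (exp a)"
  proof (cases "a \<ge> 0")
    case True
    obtain t where t: "\<bar>t\<bar> \<le> \<bar>a\<bar>" "exp a = (\<Sum>m<2. a ^ m / fact m) + exp t / fact 2 * a ^ 2"
      using Maclaurin_exp_le[of a 2] by auto
    have "exp t * a\<^sup>2 \<le> exp a * a\<^sup>2" using t(1) True by (intro mult_right_mono) auto
    moreover have "exp a = 1 + a + exp t * a\<^sup>2 / 2"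
      using t(2) by (simp add: numeral_2_eq_2)
    moreover have "max 1 (exp a) = exp a" using True by (simp add: max_def)
    ultimately show ?thesis by (simp only:) (simp add: mult.commute)
  next
    case False
    have "(\<lambda>x. 1 + x + x\<^sup>2 / 2 - exp x) 0 \<le> (\<lambda>x. 1 + x + x\<^sup>2 / 2 - exp x) a"
    proof (rule DERIV_nonpos_imp_nonincreasing[of a 0])
      fix x :: real
      have "((\<lambda>x. 1 + x + x\<^sup>2 / 2 - exp x) has_real_derivative (1 + x - exp x)) (at x)"
        by (auto intro!: derivative_eq_intros)
      moreover have "1 + x - exp x \<le> 0" using exp_ge_add_one_self[of x] by simp
      ultimately show "\<exists>y. ((\<lambda>x. 1 + x + x\<^sup>2 / 2 - exp x) has_real_derivative y) (at x) \<and> y \<le> 0"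
        by blast
    qed (use False in auto)
    thus ?thesis using False by (simp add: max_def)
  qed
  ultimately show ?thesis by linarith
qed

text \<open>
  Taylor expansion under the integral sign: \<open>exp (d v)\<close> is \<open>1 + d v\<close> up to \<open>O(d\<^sup>2 v\<^sup>2)\<close>, and the linear term
  integrates to the first moment.
\<close>

lemma mills_taylor:
  "\<exists>C\<ge>0. \<forall>d. \<bar>d\<bar> \<le> 1 \<longrightarrow> \<bar>mills (\<gamma> + d) - mills \<gamma> - (1 + \<gamma> * mills \<gamma>) * d\<bar> \<le> C * d\<^sup>2"
proof (intro exI conjI allI impI)
  let ?E = "\<lambda>v. exp (\<gamma> * v - v\<^sup>2 / 2)"
  let ?K = "exp ((\<bar>\<gamma>\<bar> + 1 + 1)\<^sup>2 / 2)"
  show "0 \<le> ?K * poly_exp_moment 2"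
    using poly_exp_moment_nonneg[of 2] by simp
  fix d :: real assume d: "\<bar>d\<bar> \<le> 1"
  let ?f = "\<lambda>v. exp ((\<gamma> + d) * v - v\<^sup>2 / 2) - ?E v - d * (v * ?E v)"
  have "(LBINT v:{0<..}. ?f v) = mills (\<gamma> + d) - mills \<gamma> - (LBINT v:{0<..}. d * (v * ?E v))"
    unfolding mills_def using gauss_integrable[of \<gamma>] gauss_integrable[of "\<gamma> + d"] gauss_integrable_pow[of 1 \<gamma>]
    by (subst set_integral_diff(2), (auto intro!: set_integral_diff set_integrable_mult_right)[2])+ simp_all
  hence eq: "(LBINT v:{0<..}. ?f v) = mills (\<gamma> + d) - mills \<gamma> - (1 + \<gamma> * mills \<gamma>) * d"
    by (simp add: gauss_first_moment)
  have "\<bar>LBINT v:{0<..}. ?f v\<bar> \<le> (?K * d\<^sup>2) * poly_exp_moment 2"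
  proof (rule dominated_half_line)
    show "?f \<in> borel_measurable borel" by measurable
    fix v :: real assume v: "0 < v"
    have E: "exp ((\<gamma> + d) * v - v\<^sup>2 / 2) \<le> ?K * exp (- v)" "?E v \<le> ?K * exp (- v)"
      unfolding exp_add[symmetric] exp_le_cancel_iff using d v
      gauss_exponent_le[of "\<gamma> + d" "\<bar>\<gamma>\<bar> + 1" v] gauss_exponent_le[of "\<gamma>" "\<bar>\<gamma>\<bar> + 1" v] by auto
    have E_add: "exp ((\<gamma> + d) * v - v\<^sup>2 / 2) = ?E v * exp (d * v)"
      unfolding exp_add[symmetric] by (simp add: algebra_simps)
    have "?f v = ?E v * (exp (d * v) - 1 - d * v)"
      unfolding E_add by (simp add: algebra_simps)
    hence "\<bar>?f v\<bar> = ?E v * \<bar>exp (d * v) - 1 - d * v\<bar>" by (simp add: abs_mult)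
    also have "\<dots> \<le> ?E v * ((d * v)\<^sup>2 / 2 * max 1 (exp (d * v)))"
      by (intro mult_left_mono exp_second_order) auto
    also have "\<dots> = (d * v)\<^sup>2 / 2 * max (?E v) (exp ((\<gamma> + d) * v - v\<^sup>2 / 2))"
      unfolding E_add by (simp add: max_def)
    also have "\<dots> \<le> (d * v)\<^sup>2 / 2 * (?K * exp (- v))"
      using E by (intro mult_left_mono) auto
    also have "\<dots> \<le> (d\<^sup>2 * (1 + v)\<^sup>2) * (?K * exp (- v))"
    proof (rule mult_right_mono)
      have "v\<^sup>2 / 2 \<le> (1 + v)\<^sup>2" using v by (simp add: power2_eq_square algebra_simps)
      from mult_left_mono[OF this, of "d\<^sup>2"] show "(d * v)\<^sup>2 / 2 \<le> d\<^sup>2 * (1 + v)\<^sup>2"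
        by (simp add: power_mult_distrib)
    qed auto
    finally show "\<bar>?f v\<bar> \<le> (?K * d\<^sup>2) * ((1 + v)\<^sup>2 * exp (- v))" by (simp add: mult_ac)
  qed
  thus "\<bar>mills (\<gamma> + d) - mills \<gamma> - (1 + \<gamma> * mills \<gamma>) * d\<bar> \<le> ?K * poly_exp_moment 2 * d\<^sup>2"
    unfolding eq by (simp add: mult_ac)
qed

lemma mills_DERIV: "(mills has_real_derivative 1 + \<gamma> * mills \<gamma>) (at \<gamma>)"
proof -
  obtain C where C: "C \<ge> 0" "\<And>d. \<bar>d\<bar> \<le> 1 \<Longrightarrow> \<bar>mills (\<gamma> + d) - mills \<gamma> - (1 + \<gamma> * mills \<gamma>) * d\<bar> \<le> C * d\<^sup>2"
    using mills_taylor[of \<gamma>] by blast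
  show ?thesis unfolding DERIV_def
  proof (rule LIM_zero_cancel, rule Lim_null_comparison)
    show "\<forall>\<^sub>F d in at 0. norm ((mills (\<gamma> + d) - mills \<gamma>) / d - (1 + \<gamma> * mills \<gamma>)) \<le> C * \<bar>d\<bar>"
    proof -
      have "\<forall>\<^sub>F d in at 0. d \<in> {-1<..<1::real} - {0}"
        by (rule eventually_at_in_open) auto
      thus ?thesis
      proof eventually_elim
        fix d :: real assume "d \<in> {-1<..<1} - {0}"
        hence d: "\<bar>d\<bar> \<le> 1" "d \<noteq> 0" by auto
        hence "norm ((mills (\<gamma> + d) - mills \<gamma>) / d - (1 + \<gamma> * mills \<gamma>)) = 
            \<bar>mills (\<gamma> + d) - mills \<gamma> - (1 + \<gamma> * mills \<gamma>) * d\<bar> / \<bar>d\<bar>"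
          by (simp add: diff_divide_distrib flip: abs_divide)
        also have "\<dots> \<le> C * d\<^sup>2 / \<bar>d\<bar>" using C(2)[OF d(1)] by (intro divide_right_mono) auto
        also have "d\<^sup>2 = \<bar>d\<bar> * \<bar>d\<bar>" by (simp add: power2_eq_square)
        also have "C * (\<bar>d\<bar> * \<bar>d\<bar>) / \<bar>d\<bar> = C * \<bar>d\<bar>"
          using d nonzero_mult_div_cancel_right[of "\<bar>d\<bar>" "C * \<bar>d\<bar>"] by (simp only: mult.assoc abs_eq_0 simp_thms)
        finally show "norm ((mills (\<gamma> + d) - mills \<gamma>) / d - (1 + \<gamma> * mills \<gamma>)) \<le> C * \<bar>d\<bar>" .
      qed
    qed
    show "((\<lambda>d. C * \<bar>d\<bar>) \<longlongrightarrow> 0) (at 0)"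
      by (auto intro!: tendsto_eq_intros)
  qed
qed

lemma mills_strict_mono: "x < y \<Longrightarrow> mills x < mills y"
  by (rule DERIV_pos_imp_increasing[of x y mills]) (use mills_DERIV mills_deriv_pos in blast)+

lemma delta_inf_unique:
  assumes "0 < \<epsilon>"
  shows "\<exists>!\<delta>. g_inf \<delta> = \<epsilon>"
proof -
  have iff: "g_inf \<delta> = \<epsilon> \<longleftrightarrow> mills \<delta> = 1 / \<epsilon>" for \<delta>
    using assms mills_pos[of \<delta>] unfolding g_inf_eq by auto
  have cont: "continuous_on A mills" for A
    using mills_DERIV by (meson DERIV_isCont continuous_at_imp_continuous_on)
  \<comment> \<open>For \<open>a < 0\<close>, positivity of \<open>1 + a * mills a\<close> gives \<open>mills a < 1 / (- a)\<close>, which is at most \<open>1 / \<epsilon>\<close> if \<open>a < - \<epsilon>\<close>.\<close>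
  define a where "a = - \<epsilon> - 1"
  have "mills a \<le> 1 / \<epsilon>"
  proof -
    have a: "a < 0" "-a > \<epsilon>" using assms by (auto simp: a_def)
    have "(- a) * mills a < 1" using mills_deriv_pos[of a] by simp
    moreover have "\<epsilon> * mills a \<le> (- a) * mills a" using a mills_pos[of a] by (intro mult_right_mono) auto
    ultimately show ?thesis using assms by (simp add: field_simps)
  qed
  \<comment> \<open>On the positive axis the derivative of \<open>mills\<close> is at least \<open>1\<close>, so \<open>mills\<close> is unbounded.\<close>
  have lin: "mills x \<ge> mills 0 + x" if "x \<ge> 0" for x
  proof -
    have "(\<lambda>t. mills t - t) 0 \<le> (\<lambda>t. mills t - t) x"
    proof (rule DERIV_nonneg_imp_nondecreasing[of 0 x])
      fix t :: real assume "0 \<le> t"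
      hence "0 \<le> t * mills t" using mills_pos[of t] by simp
      moreover have "((\<lambda>t. mills t - t) has_real_derivative (1 + t * mills t - 1)) (at t)"
        by (intro derivative_intros mills_DERIV)
      ultimately show "\<exists>y. ((\<lambda>t. mills t - t) has_real_derivative y) (at t) \<and> 0 \<le> y"
        by (intro exI[of _ "1 + t * mills t - 1"]) auto
    qed (use that in auto)
    thus ?thesis by simp
  qed
  have "\<exists>x\<ge>a. x \<le> 1 / \<epsilon> \<and> mills x = 1 / \<epsilon>"
  proof (rule IVT')
    show "1 / \<epsilon> \<le> mills (1 / \<epsilon>)" using lin[of "1 / \<epsilon>"] mills_pos[of 0] assms by simp
    show "a \<le> 1 / \<epsilon>" using assms by (auto simp: a_def intro: order_trans[of _ 0])
  qed fact+
  moreover have "x = y" if "mills x = 1 / \<epsilon>" "mills y = 1 / \<epsilon>" for x y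
    using that mills_strict_mono[of x y] mills_strict_mono[of y x] by (metis linorder_neqE_linordered_idom less_irrefl)
  ultimately show ?thesis unfolding iff by blast
qed

lemma mills_delta_inf: "0 < \<epsilon> \<Longrightarrow> mills (delta_inf \<epsilon>) = 1 / \<epsilon>"
proof -
  assume "0 < \<epsilon>"
  hence "g_inf (delta_inf \<epsilon>) = \<epsilon>"
    unfolding delta_inf_def by (rule theI'[OF delta_inf_unique])
  moreover have "mills (delta_inf \<epsilon>) = 1 / g_inf (delta_inf \<epsilon>)" by (simp add: g_inf_eq)
  ultimately show ?thesis by simp
qed

lemma deriv_g_inf: "deriv g_inf \<gamma> = - (1 + \<gamma> * mills \<gamma>) / (mills \<gamma>)\<^sup>2"
proof -
  have "g_inf = (\<lambda>x. 1 / mills x)" by (rule ext) (rule g_inf_eq)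
  moreover have "((\<lambda>x. 1 / mills x) has_real_derivative - (1 + \<gamma> * mills \<gamma>) / (mills \<gamma>)\<^sup>2) (at \<gamma>)"
    using mills_pos[of \<gamma>] by (auto intro!: derivative_eq_intros mills_DERIV simp: power2_eq_square)
  ultimately show ?thesis by (simp add: DERIV_imp_deriv)
qed

section \<open>Second-order expansion of the Erlang B function\<close>

text \<open>
  Expanding \<open>(1 + v / m)\<^sup>s\<close> by the binomial theorem and integrating against \<open>exp (- n v)\<close> termwise gives the
  sum in the denominator of the Erlang B function, in reverse order.
\<close>

lemma erlang_B_integral:
  assumes n: "0 < n" "n\<^sup>2 = real s" and m: "0 < m"
  shows "inverse (erlang_B s (n * m)) / n = (LBINT v:{0<..}. exp (n\<^sup>2 * ln (1 + v / m) - n * v))"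
proof -
  let ?f = "\<lambda>v::real. indicator {0<..} v *\<^sub>R exp (n\<^sup>2 * ln (1 + v / m) - n * v)"
  let ?h = "\<lambda>k v::real. indicator {0<..} v *\<^sub>R (v ^ k * exp (- n * v))"
  have "?f v = (\<Sum>k\<le>s. of_nat (s choose k) / m ^ k * ?h k v)" for v
  proof (cases "v > 0")
    case True
    have "exp (n\<^sup>2 * ln (1 + v / m)) = (1 + v / m) ^ s"
      unfolding n(2) using True m by (subst exp_of_nat_mult) (auto simp: add_pos_pos)
    also have "\<dots> = (\<Sum>k\<le>s. of_nat (s choose k) / m ^ k * v ^ k)"
      unfolding add.commute[of 1] binomial_ring by (simp add: power_divide)
    finally have "exp (n\<^sup>2 * ln (1 + v / m) - n * v) = (\<Sum>k\<le>s. of_nat (s choose k) / m ^ k * v ^ k) * exp (- n * v)"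
      by (simp add: exp_diff exp_minus divide_inverse)
    thus ?thesis using True by (simp add: sum_distrib_left sum_distrib_right mult_ac)
  qed auto
  hence "has_bochner_integral lborel ?f (\<Sum>k\<le>s. of_nat (s choose k) / m ^ k * (fact k / n ^ Suc k))"
    using has_bochner_integral_pow_exp_scaled[OF n(1)]
    by (simp only:) (intro has_bochner_integral_sum has_bochner_integral_mult_right)
  hence "(LBINT v:{0<..}. exp (n\<^sup>2 * ln (1 + v / m) - n * v)) = 
      (\<Sum>k\<le>s. of_nat (s choose k) / m ^ k * (fact k / n ^ Suc k))"
    unfolding set_lebesgue_integral_def by (rule has_bochner_integral_integral_eq)
  also have "\<dots> = (\<Sum>k\<le>s. (n * m) ^ (s - k) / fact (s - k) * (fact s / (n * m) ^ s) / n)"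
  proof (rule sum.cong)
    fix k assume "k \<in> {..s}"
    hence k: "k \<le> s" by simp
    have "(n * m) ^ s = (n * m) ^ (s - k) * (n * m) ^ k"
      using k by (simp flip: power_add)
    thus "of_nat (s choose k) / m ^ k * (fact k / n ^ Suc k) = 
        (n * m) ^ (s - k) / fact (s - k) * (fact s / (n * m) ^ s) / n"
      using n m by (simp add: binomial_fact[OF k] power_mult_distrib)
  qed auto
  also have "\<dots> = (\<Sum>k\<le>s. (n * m) ^ k / fact k * (fact s / (n * m) ^ s) / n)"
    by (rule sum.reindex_bij_witness[of _ "\<lambda>k. s - k" "\<lambda>k. s - k"]) auto
  also have "\<dots> = inverse (erlang_B s (n * m)) / n"
    by (simp add: erlang_B_def sum_distrib_left sum_distrib_right sum_divide_distrib mult_ac)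
  finally show ?thesis by simp
qed

lemma ln_one_plus_bounds:
  fixes x :: real
  assumes "0 \<le> x"
  shows "ln (1 + x) \<le> x - x\<^sup>2 / 2 + x ^ 3 / 3"
    and "x - x\<^sup>2 / 2 + x ^ 3 / 3 - x ^ 4 / 4 \<le> ln (1 + x)"
    and "ln (1 + x) \<le> x - x\<^sup>2 / (2 * (1 + x))"
proof -
  have *: "0 \<le> f x" if "f 0 = 0" "\<And>t. 0 \<le> t \<Longrightarrow> (f has_real_derivative f' t) (at t)" "\<And>t. 0 \<le> t \<Longrightarrow> 0 \<le> f' t"
    for f f' :: "real \<Rightarrow> real"
    using DERIV_nonneg_imp_nondecreasing[of 0 x f] that assms by (metis less_eq_real_def)
  have "0 \<le> x - x\<^sup>2 / 2 + x ^ 3 / 3 - ln (1 + x)"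
  proof (rule *[where f' = "\<lambda>t. t ^ 3 / (1 + t)"])
    fix t :: real assume t: "0 \<le> t"
    show "((\<lambda>x. x - x\<^sup>2 / 2 + x ^ 3 / 3 - ln (1 + x)) has_real_derivative t ^ 3 / (1 + t)) (at t)"
      using t by (auto intro!: derivative_eq_intros simp: field_simps power2_eq_square power3_eq_cube)
  qed auto
  thus "ln (1 + x) \<le> x - x\<^sup>2 / 2 + x ^ 3 / 3" by simp
  have "0 \<le> ln (1 + x) - (x - x\<^sup>2 / 2 + x ^ 3 / 3 - x ^ 4 / 4)"
  proof (rule *[where f' = "\<lambda>t. t ^ 4 / (1 + t)"])
    fix t :: real assume t: "0 \<le> t"
    show "((\<lambda>x. ln (1 + x) - (x - x\<^sup>2 / 2 + x ^ 3 / 3 - x ^ 4 / 4)) has_real_derivative t ^ 4 / (1 + t)) (at t)"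
      using t by (auto intro!: derivative_eq_intros simp: field_simps power2_eq_square power3_eq_cube power4_eq_xxxx)
  qed auto
  thus "x - x\<^sup>2 / 2 + x ^ 3 / 3 - x ^ 4 / 4 \<le> ln (1 + x)" by simp
  have "0 \<le> x - x\<^sup>2 / (2 * (1 + x)) - ln (1 + x)"
  proof (rule *[where f' = "\<lambda>t. t\<^sup>2 / (2 * (1 + t)\<^sup>2)"])
    fix t :: real assume t: "0 \<le> t"
    have "1 + t \<noteq> 0" using t by simp
    hence "1 - (2 * t * (2 * (1 + t)) - t\<^sup>2 * 2) / (2 * (1 + t))\<^sup>2 - 1 / (1 + t) = t\<^sup>2 / (2 * (1 + t)\<^sup>2)"
      by (simp add: divide_simps) (simp add: algebra_simps power2_eq_square)
    thus "((\<lambda>x. x - x\<^sup>2 / (2 * (1 + x)) - ln (1 + x)) has_real_derivative t\<^sup>2 / (2 * (1 + t)\<^sup>2)) (at t)"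
      using t by (auto intro!: derivative_eq_intros simp: power2_eq_square)
  qed auto
  thus "ln (1 + x) \<le> x - x\<^sup>2 / (2 * (1 + x))" by simp
qed

lemma power_le_one_plus_power:
  fixes v :: real
  assumes "0 \<le> v" "k \<le> n"
  shows "v ^ k \<le> (1 + v) ^ n"
proof -
  have "v ^ k \<le> (1 + v) ^ k" using assms by (intro power_mono) auto
  also have "\<dots> \<le> (1 + v) ^ n" using assms by (intro power_increasing) auto
  finally show ?thesis .
qed

text \<open>
  With \<open>n = m + \<gamma>\<close>, the Taylor polynomial of \<open>ln (1 + v / m)\<close> of degree three already produces the Gaussian
  exponent and the cubic correction; expanding in \<open>1 / m\<close> rather than in \<open>1 / n\<close> makes \<open>R\<close> in the
  remainder \<open>R / m\<^sup>2\<close> a polynomial in \<open>\<gamma>\<close>, \<open>v\<close> and \<open>1 / m\<close>. The quartic lower bound for the logarithm contributes \<open>Q / m\<^sup>2\<close>.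
\<close>

lemma exponent_expansion:
  fixes m \<gamma> v G :: real
  assumes G: "\<bar>\<gamma>\<bar> \<le> G" and m: "1 + G \<le> m" and v: "0 \<le> v"
  shows "\<bar>((m + \<gamma>)\<^sup>2 * ln (1 + v / m) - (m + \<gamma>) * v) - (\<gamma> * v - v\<^sup>2 / 2) - 
      (\<gamma>\<^sup>2 * v - \<gamma> * v\<^sup>2 + v ^ 3 / 3) / m\<bar> \<le> 3 * (1 + G)\<^sup>2 * (1 + v) ^ 4 / m\<^sup>2"
proof -
  define u x where "u = 1 / m" and "x = v / m"
  have m0: "m > 0" using G m by linarith
  have u: "0 < u" "u \<le> 1" "\<bar>\<gamma>\<bar> * u \<le> 1"
    using m0 G m by (auto simp: u_def field_simps)
  have mu: "m * u = 1" and xu: "x = u * v" using m0 by (auto simp: u_def x_def)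
  have x: "x \<ge> 0" using m0 v by (simp add: x_def)
  define H where "H = 1 + G"
  define W where "W = (1 + v) ^ 4"
  define B where "B = H\<^sup>2 * W"
  have W0: "0 \<le> W" by (simp add: W_def)
  have vW: "v\<^sup>2 \<le> W" "v ^ 3 \<le> W" "v ^ 4 \<le> W"
  proof -
    show "v\<^sup>2 \<le> W" "v ^ 3 \<le> W" "v ^ 4 \<le> W"
      unfolding W_def using v by (intro power_le_one_plus_power; simp)+
  qed
  have H: "1 \<le> H" "1 \<le> H\<^sup>2" "\<bar>\<gamma>\<bar> \<le> H\<^sup>2" "\<gamma>\<^sup>2 \<le> H\<^sup>2"
  proof -
    show 1: "1 \<le> H" using G by (simp add: H_def)
    thus "1 \<le> H\<^sup>2" by simp
    have "H * 1 \<le> H * H" using 1 by (intro mult_left_mono) auto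
    thus "\<bar>\<gamma>\<bar> \<le> H\<^sup>2" using G by (simp add: power2_eq_square H_def)
    show "\<gamma>\<^sup>2 \<le> H\<^sup>2" using G by (intro abs_le_square_iff[THEN iffD1]) (auto simp: H_def)
  qed
  define R where "R = - (\<gamma>\<^sup>2 * v\<^sup>2) / 2 + 2 / 3 * (\<gamma> * v ^ 3) + (\<gamma>\<^sup>2 * (u * v ^ 3)) / 3"
  define Q where "Q = (1 + \<gamma> * u)\<^sup>2 * v ^ 4 / 4"
  let ?E = "\<gamma> * v - v\<^sup>2 / 2" and ?p = "\<gamma>\<^sup>2 * v - \<gamma> * v\<^sup>2 + v ^ 3 / 3"
  have R_eq: "(m + \<gamma>)\<^sup>2 * (x - x\<^sup>2 / 2 + x ^ 3 / 3) - (m + \<gamma>) * v - ?E - ?p / m = R / m\<^sup>2"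
  proof -
    have "(m + \<gamma>)\<^sup>2 * x = (m + 2 * \<gamma> + \<gamma>\<^sup>2 * u) * v"
      "(m + \<gamma>)\<^sup>2 * x\<^sup>2 = (1 + 2 * \<gamma> * u + \<gamma>\<^sup>2 * u\<^sup>2) * v\<^sup>2"
      "(m + \<gamma>)\<^sup>2 * x ^ 3 = (u + 2 * \<gamma> * u\<^sup>2 + \<gamma>\<^sup>2 * u ^ 3) * v ^ 3"
      using mu xu by algebra+
    hence "(m + \<gamma>)\<^sup>2 * (x - x\<^sup>2 / 2 + x ^ 3 / 3) - (m + \<gamma>) * v = 
        (m + 2 * \<gamma> + \<gamma>\<^sup>2 * u) * v - (1 + 2 * \<gamma> * u + \<gamma>\<^sup>2 * u\<^sup>2) * v\<^sup>2 / 2 + 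
        (u + 2 * \<gamma> * u\<^sup>2 + \<gamma>\<^sup>2 * u ^ 3) * v ^ 3 / 3 - (m + \<gamma>) * v"
      by (simp add: distrib_left right_diff_distrib)
    also have "\<dots> = ?E + ?p * u + R * u\<^sup>2"
      by (simp add: R_def algebra_simps power2_eq_square power3_eq_cube add_divide_distrib diff_divide_distrib)
    finally show ?thesis by (simp add: u_def power_divide)
  qed
  have Q_eq: "(m + \<gamma>)\<^sup>2 * (x ^ 4 / 4) = Q / m\<^sup>2"
  proof -
    have "(m + \<gamma>)\<^sup>2 * x ^ 4 = (1 + \<gamma> * u)\<^sup>2 * v ^ 4 * u\<^sup>2"
      using mu xu by algebra
    thus ?thesis by (simp add: Q_def u_def power_divide)
  qed
  have "\<bar>\<gamma>\<^sup>2 * v\<^sup>2\<bar> \<le> B"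
    unfolding B_def abs_mult using H vW v by (intro mult_mono) auto
  moreover have "\<bar>\<gamma> * v ^ 3\<bar> \<le> B"
    unfolding B_def abs_mult using H vW v by (intro mult_mono) auto
  moreover have "\<bar>\<gamma>\<^sup>2 * (u * v ^ 3)\<bar> \<le> B"
  proof -
    have "u * v ^ 3 \<le> 1 * W" using u vW v by (intro mult_mono) auto
    thus ?thesis unfolding B_def abs_mult using H v u by (intro mult_mono) (auto simp: abs_mult)
  qed
  ultimately have R: "\<bar>R\<bar> \<le> 3 / 2 * B" unfolding R_def by linarith
  have "0 \<le> Q" unfolding Q_def by simp
  moreover have "Q \<le> B"
  proof -
    have "\<bar>1 + \<gamma> * u\<bar> \<le> 2" 
    proof -
      have "\<bar>\<gamma> * u\<bar> \<le> 1" using u by (simp add: abs_mult)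
      thus ?thesis by linarith
    qed
    hence "(1 + \<gamma> * u)\<^sup>2 \<le> 2\<^sup>2"
      using power_mono[of "\<bar>1 + \<gamma> * u\<bar>" 2 2] by (simp only: power2_abs abs_ge_zero)
    hence "(1 + \<gamma> * u)\<^sup>2 * v ^ 4 \<le> 4 * W" using vW v by (intro mult_mono) auto
    hence "Q \<le> 1 * W" unfolding Q_def by linarith
    also have "\<dots> \<le> B"
      unfolding B_def using H(2) W0 by (rule mult_right_mono)
    finally show ?thesis .
  qed
  moreover have "\<bar>R / m\<^sup>2\<bar> = \<bar>R\<bar> / m\<^sup>2" by simp
  ultimately have "\<bar>R / m\<^sup>2\<bar> \<le> (3 / 2 * B) / m\<^sup>2" "0 \<le> Q / m\<^sup>2" "Q / m\<^sup>2 \<le> B / m\<^sup>2"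
    using divide_right_mono[OF R, of "m\<^sup>2"] divide_right_mono[of Q B "m\<^sup>2"] by simp_all
  moreover have "(m + \<gamma>)\<^sup>2 * ln (1 + x) \<le> (m + \<gamma>)\<^sup>2 * (x - x\<^sup>2 / 2 + x ^ 3 / 3)"
    "(m + \<gamma>)\<^sup>2 * (x - x\<^sup>2 / 2 + x ^ 3 / 3 - x ^ 4 / 4) \<le> (m + \<gamma>)\<^sup>2 * ln (1 + x)"
    by (intro mult_left_mono ln_one_plus_bounds x; simp)+
  moreover have "0 \<le> B / m\<^sup>2" using W0 by (simp add: B_def)
  moreover have "(3 / 2 * B) / m\<^sup>2 = 3 / 2 * (B / m\<^sup>2)" by simp
  ultimately have "\<bar>((m + \<gamma>)\<^sup>2 * ln (1 + x) - (m + \<gamma>) * v) - ?E - ?p / m\<bar> \<le> 3 * (B / m\<^sup>2)"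
    using R_eq Q_eq unfolding right_diff_distrib[of _ _ "x ^ 4 / 4"] abs_le_iff by linarith
  thus ?thesis by (simp add: B_def H_def W_def x_def)
qed

text \<open>
  Taylor polynomials of the logarithm are useless for \<open>v\<close> much larger than \<open>m\<close>. The bound
  \<open>ln (1 + x) \<le> x - x\<^sup>2 / (2 (1 + x))\<close> yields at most \<open>2 G v - (v / 8) (m v / (m + v))\<close>, and for \<open>m, v \<ge> L\<close> the
  last factor is at least \<open>L / 2\<close>; \<open>L = 16 (2 G + 1)\<close> is chosen to leave \<open>- v\<close>.
\<close>

lemma exponent_dominated:
  fixes m \<gamma> v G :: real
  assumes G: "\<bar>\<gamma>\<bar> \<le> G" and m: "16 * (2 * G + 1) \<le> m" and v: "0 \<le> v"
  shows "(m + \<gamma>)\<^sup>2 * ln (1 + v / m) - (m + \<gamma>) * v \<le> 16 * (2 * G + 1)\<^sup>2 - v"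
proof -
  define L where "L = 16 * (2 * G + 1)"
  define n where "n = m + \<gamma>"
  have G0: "G \<ge> 0" using G by linarith
  have m0: "m > 0" "n \<le> 2 * m" "m / 2 \<le> n" "m \<ge> L" "0 \<le> n"
    using G m G0 by (auto simp: n_def L_def)
  have "n\<^sup>2 * ln (1 + v / m) \<le> n\<^sup>2 * (v / m - (v / m)\<^sup>2 / (2 * (1 + v / m)))"
    using m0 v ln_one_plus_bounds(3)[of "v / m"] by (intro mult_left_mono) auto
  also have "(v / m)\<^sup>2 / (2 * (1 + v / m)) = v\<^sup>2 / (2 * m * (m + v))"
    using m0 v by (simp add: divide_simps) (simp add: algebra_simps power2_eq_square)
  finally have 1: "n\<^sup>2 * ln (1 + v / m) - n * v \<le> n\<^sup>2 * (v / m) - n * v - n\<^sup>2 * v\<^sup>2 / (2 * m * (m + v))"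
    by (simp add: algebra_simps)
  have "n\<^sup>2 * (v / m) - n * v = \<gamma> * (v * (n / m))"
    using m0 by (simp add: n_def field_simps power2_eq_square)
  also have "\<dots> \<le> G * (v * 2)"
    using G G0 v m0 by (intro mult_mono) (auto simp: field_simps)
  finally have 2: "n\<^sup>2 * (v / m) - n * v \<le> 2 * G * v" by simp
  show ?thesis
  proof (cases "v \<ge> L")
    case True
    have L0: "L > 0" using G0 by (simp add: L_def)
    have "(m / 2)\<^sup>2 \<le> n\<^sup>2" using m0 by (intro power_mono) auto
    hence "(m / 2)\<^sup>2 * v\<^sup>2 / (2 * m * (m + v)) \<le> n\<^sup>2 * v\<^sup>2 / (2 * m * (m + v))"
      using m0 v by (intro divide_right_mono mult_right_mono) auto
    moreover have "(m / 2)\<^sup>2 * v\<^sup>2 / (2 * m * (m + v)) = v / 8 * (m * v / (m + v))"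
    proof -
      have "m + v \<noteq> 0" "m \<noteq> 0" using m0 v by linarith+
      thus ?thesis by (simp add: divide_simps power2_eq_square)
    qed
    moreover have "L / 2 \<le> m * v / (m + v)"
    proof -
      have "L * v \<le> m * v" "m * L \<le> m * v" using True m0 v by (auto intro!: mult_right_mono)
      hence "L * (m + v) \<le> 2 * (m * v)" by (simp add: algebra_simps)
      thus ?thesis using m0 v by (simp add: field_simps)
    qed
    hence "v / 8 * (L / 2) \<le> v / 8 * (m * v / (m + v))" using v by (intro mult_left_mono) auto
    moreover have "v / 8 * (L / 2) = (2 * G + 1) * v" by (simp add: L_def)
    ultimately have "n\<^sup>2 * ln (1 + v / m) - n * v \<le> 2 * G * v - (2 * G + 1) * v"
      using 1 2 by linarith
    also have "\<dots> = - v" by (simp add: algebra_simps)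
    also have "\<dots> \<le> 16 * (2 * G + 1)\<^sup>2 - v" by simp
    finally show ?thesis by (simp add: n_def)
  next
    case False
    have "0 \<le> n\<^sup>2 * v\<^sup>2 / (2 * m * (m + v))" using m0 v by (intro divide_nonneg_nonneg) auto
    hence "n\<^sup>2 * ln (1 + v / m) - n * v \<le> 2 * G * v" using 1 2 by linarith
    also have "\<dots> = (2 * G + 1) * v - v" by (simp add: algebra_simps)
    also have "(2 * G + 1) * v \<le> (2 * G + 1) * L" using False G0 by (intro mult_left_mono) auto
    also have "\<dots> = 16 * (2 * G + 1)\<^sup>2" by (simp add: L_def power2_eq_square)
    finally show ?thesis by (simp add: n_def)
  qed
qed

text \<open>
  If \<open>a\<close> is the difference of the two exponents, then \<open>a = O((1 + v)\<^sup>4 / m)\<close> and \<open>a - p / m = O((1 + v)\<^sup>4 / m\<^sup>2)\<close>,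
  so replacing \<open>exp a\<close> by \<open>1 + p / m\<close> costs \<open>O((1 + v)\<^sup>8 / m\<^sup>2)\<close> times one of the two dominated exponentials.
\<close>

lemma laplace_integrand:
  fixes m \<gamma> v G :: real
  assumes G: "\<bar>\<gamma>\<bar> \<le> G" and m: "16 * (2 * G + 1) \<le> m" and v: "0 \<le> v"
  defines "E \<equiv> \<gamma> * v - v\<^sup>2 / 2" and "p \<equiv> \<gamma>\<^sup>2 * v - \<gamma> * v\<^sup>2 + v ^ 3 / 3"
  shows "\<bar>exp ((m + \<gamma>)\<^sup>2 * ln (1 + v / m) - (m + \<gamma>) * v) - exp E - p * exp E / m\<bar> \<le>
      (21 * (1 + G) ^ 4 * exp (16 * (2 * G + 1)\<^sup>2 + (G + 1)\<^sup>2 / 2) / m\<^sup>2) * ((1 + v) ^ 8 * exp (- v))"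
proof -
  define En where "En = (m + \<gamma>)\<^sup>2 * ln (1 + v / m) - (m + \<gamma>) * v"
  define a where "a = En - E"
  define H W B where "H = 1 + G" and "W = (1 + v) ^ 4" and "B = H\<^sup>2 * W"
  have G0: "0 \<le> G" using G by linarith
  have m1: "1 \<le> m" "1 + G \<le> m" using m G0 by auto
  have W1: "1 \<le> W" unfolding W_def using v by (intro one_le_power) auto
  have H1: "1 \<le> H\<^sup>2" unfolding H_def using G0 by (intro one_le_power) auto
  have B1: "1 \<le> B" unfolding B_def using mult_mono[OF H1 W1] by simp
  have exp1: "\<bar>a - p / m\<bar> \<le> 3 * B / m\<^sup>2"
    using exponent_expansion[OF G m1(2) v]
    by (simp add: a_def En_def E_def p_def B_def H_def W_def mult.assoc)
  have "\<bar>p\<bar> \<le> 3 * B"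
  proof -
    have vW: "v \<le> W" "v\<^sup>2 \<le> W" "v ^ 3 \<le> W"
      using v power_le_one_plus_power[of v _ 4] power_le_one_plus_power[of v 1 4] by (auto simp: W_def)
    have "\<gamma>\<^sup>2 \<le> H\<^sup>2" using G by (intro abs_le_square_iff[THEN iffD1]) (auto simp: H_def)
    hence "\<bar>\<gamma>\<^sup>2 * v\<bar> \<le> B" unfolding B_def abs_mult using vW v by (intro mult_mono) auto
    moreover have "\<bar>\<gamma>\<bar> \<le> H\<^sup>2"
    proof -
      have "H * 1 \<le> H * H" using G0 by (intro mult_left_mono) (auto simp: H_def)
      thus ?thesis using G by (simp add: power2_eq_square H_def)
    qed
    hence "\<bar>\<gamma> * v\<^sup>2\<bar> \<le> B" unfolding B_def abs_mult using vW v by (intro mult_mono) auto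
    moreover have "v ^ 3 \<le> B" using mult_mono[OF H1 vW(3)] v by (simp add: B_def)
    moreover have "0 \<le> v ^ 3" using v by simp
    ultimately show ?thesis unfolding p_def by linarith
  qed
  hence "\<bar>p / m\<bar> \<le> 3 * B / m" using m1 by (auto simp: abs_divide intro!: divide_right_mono)
  moreover have "3 * B / m\<^sup>2 \<le> 3 * B / m"
    using m1 B1 by (intro divide_left_mono) (auto simp: power2_eq_square)
  ultimately have "\<bar>a\<bar> \<le> 6 * B / m" using exp1 by linarith
  hence "\<bar>a\<bar>\<^sup>2 \<le> (6 * B / m)\<^sup>2" by (intro power_mono) auto
  hence a2: "a\<^sup>2 / 2 \<le> 18 * B\<^sup>2 / m\<^sup>2" by (simp add: power_divide power_mult_distrib)
  define K where "K = exp (16 * (2 * G + 1)\<^sup>2 + (G + 1)\<^sup>2 / 2)"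
  have Een: "exp E * exp a = exp En" by (simp add: a_def flip: exp_add)
  have dom: "exp E \<le> K * exp (- v)" "exp En \<le> K * exp (- v)"
    unfolding K_def exp_add[symmetric] exp_le_cancel_iff
    using gauss_exponent_le[OF G v] exponent_dominated[OF G m v] zero_le_power2[of "2 * G + 1"] zero_le_power2[of "G + 1"]
    unfolding E_def En_def by linarith+
  have "exp En - exp E - p * exp E / m = exp E * (exp a - 1 - a) + exp E * (a - p / m)"
    unfolding Een[symmetric] by (simp add: algebra_simps)
  also have "\<bar>\<dots>\<bar> \<le> exp E * \<bar>exp a - 1 - a\<bar> + exp E * \<bar>a - p / m\<bar>"
    by (rule order_trans[OF abs_triangle_ineq]) (simp add: abs_mult)
  also have "\<dots> \<le> exp E * (a\<^sup>2 / 2 * max 1 (exp a)) + exp E * (3 * B / m\<^sup>2)"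
    using exp_second_order[of a] exp1 by (intro add_mono mult_left_mono) auto
  also have "\<dots> \<le> 18 * B\<^sup>2 / m\<^sup>2 * (K * exp (- v)) + (K * exp (- v)) * (3 * B\<^sup>2 / m\<^sup>2)"
  proof (rule add_mono)
    have "exp E * (a\<^sup>2 / 2 * max 1 (exp a)) = a\<^sup>2 / 2 * max (exp E) (exp En)"
      unfolding Een[symmetric] by (simp add: max_def)
    also have "\<dots> \<le> 18 * B\<^sup>2 / m\<^sup>2 * (K * exp (- v))"
      using a2 dom by (intro mult_mono) (auto simp: le_max_iff_disj)
    finally show "exp E * (a\<^sup>2 / 2 * max 1 (exp a)) \<le> 18 * B\<^sup>2 / m\<^sup>2 * (K * exp (- v))" .
    show "exp E * (3 * B / m\<^sup>2) \<le> (K * exp (- v)) * (3 * B\<^sup>2 / m\<^sup>2)"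
    proof (rule mult_mono[OF dom(1)])
      have "B * 1 \<le> B * B" using B1 by (intro mult_left_mono) auto
      thus "3 * B / m\<^sup>2 \<le> 3 * B\<^sup>2 / m\<^sup>2"
        by (intro divide_right_mono) (simp_all add: power2_eq_square)
      show "0 \<le> K * exp (- v)" by (simp add: K_def)
      show "0 \<le> 3 * B / m\<^sup>2" using B1 by simp
    qed
  qed
  also have "\<dots> = (21 * H ^ 4 * K / m\<^sup>2) * ((1 + v) ^ 8 * exp (- v))"
  proof -
    have "B\<^sup>2 = H ^ 4 * (1 + v) ^ 8"
      by (simp add: B_def W_def power_mult_distrib flip: power_mult)
    thus ?thesis by (simp add: divide_inverse algebra_simps)
  qed
  finally show ?thesis unfolding En_def H_def K_def .
qed

text \<open>
  The bound is uniform in \<open>n - m\<close> over \<open>[- G, G]\<close>; it will be used at points that move with \<open>s\<close>.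
\<close>

lemma erlang_B_expansion:
  assumes "0 \<le> G"
  shows "\<exists>C\<ge>0. \<forall>s n m. n\<^sup>2 = real s \<longrightarrow> 16 * (2 * G + 1) \<le> m \<longrightarrow> \<bar>n - m\<bar> \<le> G \<longrightarrow>
    \<bar>inverse (erlang_B s (n * m)) / n - mills (n - m) - mills_corr (n - m) / m\<bar> \<le> C / m\<^sup>2"
proof (intro exI conjI allI impI)
  let ?K = "21 * (1 + G) ^ 4 * exp (16 * (2 * G + 1)\<^sup>2 + (G + 1)\<^sup>2 / 2)"
  show "0 \<le> ?K * poly_exp_moment 8"
    using assms poly_exp_moment_nonneg[of 8] by (intro mult_nonneg_nonneg) auto
  fix s and n m :: real
  assume n: "n\<^sup>2 = real s" and m: "16 * (2 * G + 1) \<le> m" and G: "\<bar>n - m\<bar> \<le> G"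
  define \<gamma> where "\<gamma> = n - m"
  have pos: "0 < m" "0 < n" "n = m + \<gamma>" "\<bar>\<gamma>\<bar> \<le> G" using m G assms by (auto simp: \<gamma>_def)
  let ?En = "\<lambda>v. exp ((m + \<gamma>)\<^sup>2 * ln (1 + v / m) - (m + \<gamma>) * v)"
  let ?E = "\<lambda>v. exp (\<gamma> * v - v\<^sup>2 / 2)"
  let ?p = "\<lambda>v. \<gamma>\<^sup>2 * v - \<gamma> * v\<^sup>2 + v ^ 3 / 3"
  have int1: "set_integrable lborel {0<..} ?En"
  proof (rule dominated_half_line(1)[where C = "exp (16 * (2 * G + 1)\<^sup>2)" and k = 0])
    show "?En \<in> borel_measurable borel" by measurable
    show "\<bar>?En v\<bar> \<le> exp (16 * (2 * G + 1)\<^sup>2) * ((1 + v) ^ 0 * exp (- v))" if "0 < v" for v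
      using exponent_dominated[OF pos(4) m, of v] that by (simp flip: exp_add)
  qed
  have int2: "set_integrable lborel {0<..} (\<lambda>v. ?p v * ?E v)"
    by (rule gauss_cubic_integrable)
  have "(LBINT v:{0<..}. ?En v - ?E v - ?p v * ?E v / m) = 
      (LBINT v:{0<..}. ?En v) - mills \<gamma> - mills_corr \<gamma> / m"
    unfolding mills_def gauss_cubic_moment[symmetric]
    using int1 int2 gauss_integrable[of \<gamma>]
    by (subst set_integral_diff(2), (auto intro!: set_integral_diff(1))[2])+ simp_all
  moreover have "\<bar>LBINT v:{0<..}. ?En v - ?E v - ?p v * ?E v / m\<bar> \<le> (?K / m\<^sup>2) * poly_exp_moment 8"
  proof (rule dominated_half_line(2))
    show "(\<lambda>v. ?En v - ?E v - ?p v * ?E v / m) \<in> borel_measurable borel" by measurable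
  qed (rule laplace_integrand[OF pos(4) m], simp)
  ultimately show "\<bar>inverse (erlang_B s (n * m)) / n - mills (n - m) - mills_corr (n - m) / m\<bar> \<le> ?K * poly_exp_moment 8 / m\<^sup>2"
    using erlang_B_integral[OF pos(2) n pos(1)] unfolding \<gamma>_def[symmetric] pos(3)[symmetric] by simp
qed

section \<open>Roots of small perturbations of linear functions\<close>

lemma DERIV_locally_lipschitz:
  fixes f :: "real \<Rightarrow> real"
  assumes "(f has_real_derivative D) (at x)"
  shows "\<exists>\<rho>>0. \<forall>d. \<bar>d\<bar> \<le> \<rho> \<longrightarrow> \<bar>f (x + d) - f x\<bar> \<le> (\<bar>D\<bar> + 1) * \<bar>d\<bar>"
proof -
  have "(\<lambda>d. (f (x + d) - f x) / d) \<midarrow>0\<rightarrow> D" using assms by (simp add: DERIV_def)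
  then obtain r where r: "r > 0" "\<And>d. d \<noteq> 0 \<Longrightarrow> \<bar>d\<bar> < r \<Longrightarrow> \<bar>(f (x + d) - f x) / d - D\<bar> < 1"
    using LIM_D[of "\<lambda>d. (f (x + d) - f x) / d" D 0 1] by auto
  show ?thesis
  proof (intro exI[of _ "r / 2"] conjI allI impI)
    fix d assume d: "\<bar>d\<bar> \<le> r / 2"
    show "\<bar>f (x + d) - f x\<bar> \<le> (\<bar>D\<bar> + 1) * \<bar>d\<bar>"
    proof (cases "d = 0")
      case False
      hence "\<bar>(f (x + d) - f x) / d - D\<bar> < 1" using r d by auto
      hence "\<bar>(f (x + d) - f x) / d\<bar> \<le> \<bar>D\<bar> + 1" by linarith
      hence "\<bar>f (x + d) - f x\<bar> / \<bar>d\<bar> \<le> \<bar>D\<bar> + 1" by (simp only: abs_divide)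
      thus ?thesis using False by (simp add: pos_divide_le_eq)
    qed auto
  qed (use r in auto)
qed

text \<open>
  At \<open>x\<^sub>0 + \<kappa> / n + t\<close> with \<open>\<kappa> = - b / A\<close> and \<open>t = O(1 / n\<^sup>2)\<close> the linear part equals \<open>A t\<close>, while the error is at
  most \<open>C (2 + \<bar>\<kappa>\<bar>)\<^sup>2 / n\<^sup>2\<close>, a bound in which the constant hidden in \<open>t\<close> does not occur once \<open>n\<close> is large. So
  \<open>t = \<plusminus> K / n\<^sup>2\<close> with a large fixed \<open>K\<close> produces a change of sign.
\<close>

lemma perturbed_linear_root:
  fixes f :: "nat \<Rightarrow> real \<Rightarrow> real" and n :: "nat \<Rightarrow> real"
  assumes n: "filterlim n at_top sequentially" and A: "0 < A" and C: "0 \<le> C" and \<rho>: "0 < \<rho>"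
    and approx: "\<forall>\<^sub>F s in sequentially. \<forall>d. \<bar>d\<bar> \<le> \<rho> \<longrightarrow> 
        \<bar>f s (x\<^sub>0 + d) - (A * d + b / n s)\<bar> \<le> C * (1 / n s + \<bar>d\<bar>)\<^sup>2"
    and cont: "\<forall>\<^sub>F s in sequentially. continuous_on {x\<^sub>0 - \<rho>..x\<^sub>0 + \<rho>} (f s)"
  shows "\<exists>K\<ge>0. \<forall>\<^sub>F s in sequentially. 
    \<exists>x. \<bar>x - x\<^sub>0\<bar> \<le> \<rho> \<and> \<bar>x - x\<^sub>0 + b / (A * n s)\<bar> \<le> K / (n s)\<^sup>2 \<and> f s x = 0"
proof -
  define \<kappa> where "\<kappa> = - b / A"
  define K where "K = C * (2 + \<bar>\<kappa>\<bar>)\<^sup>2 / A + 1"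
  have K: "K \<ge> 1" using A C by (simp add: K_def)
  have AK: "A * K - C * (2 + \<bar>\<kappa>\<bar>)\<^sup>2 = A" using A by (simp add: K_def algebra_simps)
  have "\<forall>\<^sub>F s in sequentially. n s \<ge> max 1 (max K ((\<bar>\<kappa>\<bar> + 1) / \<rho>))"
    using n unfolding filterlim_at_top by blast
  with approx cont have "\<forall>\<^sub>F s in sequentially. 
    \<exists>x. \<bar>x - x\<^sub>0\<bar> \<le> \<rho> \<and> \<bar>x - x\<^sub>0 + b / (A * n s)\<bar> \<le> K / (n s)\<^sup>2 \<and> f s x = 0"
  proof eventually_elim
    case (elim s)
    define N where "N = n s"
    have N: "N \<ge> 1" "N \<ge> K" "(\<bar>\<kappa>\<bar> + 1) / \<rho> \<le> N" using elim(3) by (auto simp: N_def)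
    have N\<rho>: "(\<bar>\<kappa>\<bar> + 1) / N \<le> \<rho>" using N \<rho> by (simp add: field_simps)
    have KN: "K / N\<^sup>2 \<le> 1 / N" using N by (simp add: field_simps power2_eq_square)
    have small: "\<bar>\<kappa> / N + t\<bar> \<le> (\<bar>\<kappa>\<bar> + 1) / N" if "\<bar>t\<bar> \<le> K / N\<^sup>2" for t
    proof -
      have "\<bar>\<kappa> / N\<bar> = \<bar>\<kappa>\<bar> / N" using N by simp
      moreover have "(\<bar>\<kappa>\<bar> + 1) / N = \<bar>\<kappa>\<bar> / N + 1 / N" by (simp add: add_divide_distrib)
      ultimately show ?thesis using that KN by linarith
    qed
    have lin: "\<bar>f s (x\<^sub>0 + (\<kappa> / N + t)) - A * t\<bar> \<le> C * (2 + \<bar>\<kappa>\<bar>)\<^sup>2 / N\<^sup>2" if t: "\<bar>t\<bar> \<le> K / N\<^sup>2" for t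
    proof -
      have "\<bar>\<kappa> / N + t\<bar> \<le> \<rho>" using small[OF t] N\<rho> by linarith
      hence "\<bar>f s (x\<^sub>0 + (\<kappa> / N + t)) - (A * (\<kappa> / N + t) + b / N)\<bar> \<le> C * (1 / N + \<bar>\<kappa> / N + t\<bar>)\<^sup>2"
        using elim(1) by (simp add: N_def)
      also have "A * (\<kappa> / N + t) + b / N = A * t" using A by (simp add: \<kappa>_def field_simps)
      also have "1 / N + \<bar>\<kappa> / N + t\<bar> \<le> (2 + \<bar>\<kappa>\<bar>) / N"
        using small[OF t] by (simp add: add_divide_distrib)
      hence "C * (1 / N + \<bar>\<kappa> / N + t\<bar>)\<^sup>2 \<le> C * ((2 + \<bar>\<kappa>\<bar>) / N)\<^sup>2"
        using N C by (intro mult_left_mono power_mono) auto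
      finally show ?thesis by (simp add: power_divide)
    qed
    let ?l = "x\<^sub>0 + (\<kappa> / N + - (K / N\<^sup>2))" and ?r = "x\<^sub>0 + (\<kappa> / N + K / N\<^sup>2)"
    have KN0: "0 \<le> K / N\<^sup>2" using K by simp
    have AKN: "A * (K / N\<^sup>2) - C * (2 + \<bar>\<kappa>\<bar>)\<^sup>2 / N\<^sup>2 \<ge> 0"
      using AK A by (simp flip: diff_divide_distrib)
    have abs_KN: "\<bar>- (K / N\<^sup>2)\<bar> \<le> K / N\<^sup>2" "\<bar>K / N\<^sup>2\<bar> \<le> K / N\<^sup>2"
      using KN0 by linarith+
    have range: "\<bar>?l - x\<^sub>0\<bar> \<le> \<rho>" "\<bar>?r - x\<^sub>0\<bar> \<le> \<rho>"
      using small[OF abs_KN(1)] small[OF abs_KN(2)] N\<rho> by linarith+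
    have "\<exists>x. ?l \<le> x \<and> x \<le> ?r \<and> f s x = 0"
    proof (rule IVT')
      show "f s ?l \<le> 0" using lin[OF abs_KN(1)] AKN unfolding mult_minus_right by linarith
      show "0 \<le> f s ?r" using lin[OF abs_KN(2)] AKN by linarith
      show "?l \<le> ?r" using KN0 by simp
      show "continuous_on {?l..?r} (f s)"
        using elim(2) by (rule continuous_on_subset) (use range in auto)
    qed
    then obtain x where x: "?l \<le> x" "x \<le> ?r" "f s x = 0" by blast
    have "b / (A * N) = - (\<kappa> / N)" using A by (simp add: \<kappa>_def)
    hence "\<bar>x - x\<^sub>0 + b / (A * N)\<bar> \<le> K / N\<^sup>2" using x by linarith
    moreover have "\<bar>x - x\<^sub>0\<bar> \<le> \<rho>" using x(1,2) range by linarith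
    ultimately show ?case using x(3) by (auto simp: N_def)
  qed
  thus ?thesis using K by (intro exI[of _ K]) auto
qed

lemma erlang_B_pos: "0 < \<mu> \<Longrightarrow> 0 < erlang_B s \<mu>"
  unfolding erlang_B_def by (intro divide_pos_pos sum_pos) auto

section \<open>The blocking equation and its root\<close>

context admission_policy
begin

text \<open>
  The equation \<open>\<surd>s D = \<epsilon>\<close> cleared of its denominator; the form is affine in the reciprocal of the Erlang B
  function, for which the integral representation holds.
\<close>

definition blocking_defect :: "real \<Rightarrow> nat \<Rightarrow> real \<Rightarrow> real" where
  "blocking_defect \<epsilon> s \<delta> = (let n = sqrt s; m = n - \<delta>; F = adm_F q (m / n) in
     \<epsilon> * (inverse (erlang_B s (n * m)) / n + F / n) - 1 + \<delta> * F / m)"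

lemma blocking_defect_eq_0_iff:
  assumes "s \<ge> 1" and "\<delta> < sqrt s" and "ereal ((sqrt s - \<delta>) / sqrt s) < radius"
  shows "blocking_defect \<epsilon> s \<delta> = 0 \<longleftrightarrow> sqrt s * D_R q s (sqrt s * (sqrt s - \<delta>)) = \<epsilon>"
proof -
  define n m where "n = sqrt s" and "m = n - \<delta>"
  define F A where "F = adm_F q (m / n)" and "A = inverse (erlang_B s (n * m))"
  have n: "n > 0" "n * n = s" and m: "m > 0" using assms by (auto simp: n_def m_def)
  have F: "F \<ge> 0" using assms n m by (auto simp: F_def m_def n_def intro!: adm_F_nonneg)
  have A: "A > 0" using erlang_B_pos[of "n * m" s] n m by (simp add: A_def)
  have "s / (n * m) = n / m" "n * m / s = m / n"
    using n m by (simp_all flip: n(2))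
  moreover have "1 - n / m = - \<delta> / m" using m by (simp add: m_def field_simps)
  ultimately have D: "D_R q s (n * m) = (1 + - \<delta> / m * F) / (A + F)"
    using n m by (simp add: D_R_def F_def A_def)
  have "n * D_R q s (n * m) = \<epsilon> \<longleftrightarrow> n * (1 + - \<delta> / m * F) = \<epsilon> * (A + F)"
    unfolding D using F A by (simp add: field_simps)
  also have "\<dots> \<longleftrightarrow> (\<epsilon> * (A / n + F / n) - 1 + \<delta> * F / m) * n = 0"
    using n by (simp add: algebra_simps) argo
  also have "\<dots> \<longleftrightarrow> blocking_defect \<epsilon> s \<delta> = 0"
    using n(1) by (simp add: blocking_defect_def Let_def F_def A_def n_def m_def)
  finally show ?thesis by (simp add: n_def m_def)
qed

lemma blocking_defect_continuous_on:
  assumes "s \<ge> 1" and "\<And>\<delta>. \<delta> \<in> S \<Longrightarrow> \<delta> < sqrt s \<and> ereal ((sqrt s - \<delta>) / sqrt s) < radius"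
  shows "continuous_on S (blocking_defect \<epsilon> s)"
proof -
  define n where "n = sqrt s"
  have n: "n > 0" using assms by (simp add: n_def)
  have pos: "0 < n * (n - \<delta>)" if "\<delta> \<in> S" for \<delta> using assms(2)[OF that] n by (simp add: n_def)
  have F: "continuous_on S (\<lambda>\<delta>. adm_F q ((n - \<delta>) / n))"
  proof (rule continuous_on_compose2[of "(\<lambda>\<delta>. (n - \<delta>) / n) ` S" "adm_F q"])
    show "continuous_on ((\<lambda>\<delta>. (n - \<delta>) / n) ` S) (adm_F q)"
    proof (intro continuous_at_imp_continuous_on ballI)
      fix x assume "x \<in> (\<lambda>\<delta>. (n - \<delta>) / n) ` S"
      then obtain \<delta> where \<delta>: "\<delta> \<in> S" "x = (n - \<delta>) / n" by blast
      hence "0 \<le> x" using assms(2)[OF \<delta>(1)] n by (simp add: n_def)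
      hence "ereal \<bar>x\<bar> < radius" using assms(2)[OF \<delta>(1)] \<delta>(2) by (simp add: n_def)
      thus "isCont (adm_F q) x" by (rule DERIV_isCont[OF adm_F_DERIV])
    qed
  qed (use n in \<open>auto intro!: continuous_intros\<close>)
  have "(\<Sum>k\<le>s. (n * (n - \<delta>)) ^ k / fact k) > 0" if "\<delta> \<in> S" for \<delta>
    using pos[OF that] by (intro sum_pos) auto
  hence "continuous_on S (\<lambda>\<delta>. erlang_B s (n * (n - \<delta>)))"
    unfolding erlang_B_def by (intro continuous_intros) (auto simp: less_imp_neq[THEN not_sym])
  moreover have "erlang_B s (n * (n - \<delta>)) \<noteq> 0" if "\<delta> \<in> S" for \<delta>
    using erlang_B_pos[OF pos[OF that], of s] by simp
  moreover have "n - \<delta> \<noteq> 0" if "\<delta> \<in> S" for \<delta> using assms(2)[OF that] by (simp add: n_def)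
  ultimately show ?thesis
    unfolding blocking_defect_def Let_def n_def[symmetric] using n F
    by (intro continuous_intros) auto
qed

text \<open>
  The constant term \<open>\<epsilon> * mills \<delta>\<^sub>0 - 1\<close> vanishes by the choice of \<open>\<delta>\<^sub>0\<close>. All replacements made (of \<open>1 / m\<close> by
  \<open>1 / n\<close>, of \<open>mills_corr\<close> by its value at \<open>\<delta>\<^sub>0\<close>, of \<open>F (m / n)\<close> by \<open>F 1\<close>) cost a multiple of \<open>1 / n\<^sup>2\<close>,
  \<open>\<bar>d\<bar> / n\<close> or \<open>d\<^sup>2\<close>.
\<close>

lemma blocking_defect_expansion:
  assumes \<epsilon>: "0 < \<epsilon>" and rad: "1 < radius"
  defines "\<delta>\<^sub>0 \<equiv> delta_inf \<epsilon>"
  defines "A \<equiv> \<epsilon> * (1 + \<delta>\<^sub>0 * mills \<delta>\<^sub>0)"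
    and "b \<equiv> \<epsilon> * mills_corr \<delta>\<^sub>0 + (\<epsilon> + \<delta>\<^sub>0) * adm_F q 1"
  obtains \<rho> C where "0 < \<rho>" "\<rho> \<le> 1" "0 \<le> C"
    "\<forall>\<^sub>F s in sequentially. \<forall>d. \<bar>d\<bar> \<le> \<rho> \<longrightarrow> 
       \<delta>\<^sub>0 + d < sqrt s \<and> ereal ((sqrt s - (\<delta>\<^sub>0 + d)) / sqrt s) < radius \<and>
       \<bar>blocking_defect \<epsilon> s (\<delta>\<^sub>0 + d) - (A * d + b / sqrt s)\<bar> \<le> C * (1 / sqrt s + \<bar>d\<bar>)\<^sup>2"
proof -
  define G F\<^sub>1 c\<^sub>0 M where "G = \<bar>\<delta>\<^sub>0\<bar> + 1" and "F\<^sub>1 = adm_F q 1" and "c\<^sub>0 = mills_corr \<delta>\<^sub>0" and "M = mills \<delta>\<^sub>0"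
  have G: "G \<ge> 1" by (simp add: G_def)
  have \<epsilon>M: "\<epsilon> * M = 1" using mills_delta_inf[OF \<epsilon>] \<epsilon> by (simp add: M_def \<delta>\<^sub>0_def)
  obtain C\<^sub>1 where C1: "C\<^sub>1 \<ge> 0" "\<And>s n m. n\<^sup>2 = real s \<Longrightarrow> 16 * (2 * G + 1) \<le> m \<Longrightarrow> \<bar>n - m\<bar> \<le> G \<Longrightarrow>
      \<bar>inverse (erlang_B s (n * m)) / n - mills (n - m) - mills_corr (n - m) / m\<bar> \<le> C\<^sub>1 / m\<^sup>2"
    using erlang_B_expansion[of G] G by auto
  obtain C\<^sub>2 where C2: "C\<^sub>2 \<ge> 0" "\<And>d. \<bar>d\<bar> \<le> 1 \<Longrightarrow> \<bar>mills (\<delta>\<^sub>0 + d) - M - (1 + \<delta>\<^sub>0 * M) * d\<bar> \<le> C\<^sub>2 * d\<^sup>2"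
    using mills_taylor[of \<delta>\<^sub>0] unfolding M_def by blast
  have "\<exists>D. (mills_corr has_real_derivative D) (at \<delta>\<^sub>0)"
    unfolding mills_corr_def by (rule exI) (auto intro!: derivative_eq_intros mills_DERIV)
  then obtain D where "(mills_corr has_real_derivative D) (at \<delta>\<^sub>0)" by blast
  from DERIV_locally_lipschitz[OF this] obtain C\<^sub>3 \<rho>\<^sub>3 where C3: "C\<^sub>3 \<ge> 0" "\<rho>\<^sub>3 > 0"
    "\<And>d. \<bar>d\<bar> \<le> \<rho>\<^sub>3 \<Longrightarrow> \<bar>mills_corr (\<delta>\<^sub>0 + d) - c\<^sub>0\<bar> \<le> C\<^sub>3 * \<bar>d\<bar>"
    using that[of "\<bar>D\<bar> + 1"] by (auto simp: c\<^sub>0_def)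
  have "ereal \<bar>1\<bar> < radius" using rad by (simp add: one_ereal_def)
  from DERIV_locally_lipschitz[OF adm_F_DERIV[OF this]] obtain L \<rho>\<^sub>4 where L: "L \<ge> 0" "\<rho>\<^sub>4 > 0"
    "\<And>d. \<bar>d\<bar> \<le> \<rho>\<^sub>4 \<Longrightarrow> \<bar>adm_F q (1 + d) - F\<^sub>1\<bar> \<le> L * \<bar>d\<bar>"
    using that[of "\<bar>eval_fps (fps_deriv (adm_fps q)) 1\<bar> + 1"] by (auto simp: F\<^sub>1_def)
  obtain r' where "1 < r'" "r' < radius" using dense[OF rad] by blast
  then obtain r where r: "1 < r" "ereal r < radius" by (cases r') (auto simp: one_ereal_def)
  define \<rho> where "\<rho> = min 1 \<rho>\<^sub>3"
  have \<rho>: "0 < \<rho>" "\<rho> \<le> 1" using C3 by (auto simp: \<rho>_def)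
  define C where "C = \<epsilon> * (4 * C\<^sub>1 + C\<^sub>2 + 2 * C\<^sub>3 + 2 * \<bar>c\<^sub>0\<bar> * G + L * G) + 2 * G * (L * G) + 2 * G\<^sup>2 * \<bar>F\<^sub>1\<bar> + \<bar>F\<^sub>1\<bar>"
  have C: "C \<ge> 0" using C1 C2 C3 L \<epsilon> G unfolding C_def
    by (intro add_nonneg_nonneg mult_nonneg_nonneg) auto
  have "filterlim (\<lambda>s. sqrt (real s)) at_top sequentially"
    by (rule filterlim_compose[OF sqrt_at_top filterlim_real_sequentially])
  hence "\<forall>\<^sub>F s in sequentially. sqrt (real s) \<ge> max (16 * (2 * G + 1) + G) (max (G / \<rho>\<^sub>4) (G / (r - 1)))"
    unfolding filterlim_at_top by blast
  hence "\<forall>\<^sub>F s in sequentially. \<forall>d. \<bar>d\<bar> \<le> \<rho> \<longrightarrow> 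
       \<delta>\<^sub>0 + d < sqrt s \<and> ereal ((sqrt s - (\<delta>\<^sub>0 + d)) / sqrt s) < radius \<and>
       \<bar>blocking_defect \<epsilon> s (\<delta>\<^sub>0 + d) - (A * d + b / sqrt s)\<bar> \<le> C * (1 / sqrt s + \<bar>d\<bar>)\<^sup>2"
  proof (eventually_elim, intro allI impI)
    fix s :: nat and d :: real
    define n \<delta> m where "n = sqrt s" and "\<delta> = \<delta>\<^sub>0 + d" and "m = n - \<delta>"
    assume "sqrt (real s) \<ge> max (16 * (2 * G + 1) + G) (max (G / \<rho>\<^sub>4) (G / (r - 1)))" and d: "\<bar>d\<bar> \<le> \<rho>"
    hence n: "16 * (2 * G + 1) + G \<le> n" "G / \<rho>\<^sub>4 \<le> n" "G / (r - 1) \<le> n" by (auto simp: n_def)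
    have n0: "n > 0" "n \<ge> 2 * G" using n(1) G by auto
    have ns: "n\<^sup>2 = s" by (simp add: n_def)
    have \<delta>: "\<bar>\<delta>\<bar> \<le> G" using d \<rho> by (simp add: \<delta>_def G_def)
    have m: "16 * (2 * G + 1) \<le> m" "n \<le> 2 * m" "m > 0" "n - m = \<delta>"
      using \<delta> n n0 G by (auto simp: m_def)
    have mn: "m / n = 1 + - \<delta> / n" using n0 by (simp add: m_def field_simps)
    have small: "\<bar>- \<delta> / n\<bar> \<le> G / n" using \<delta> n0 by (simp add: divide_right_mono)
    have "G / n \<le> \<rho>\<^sub>4" "G / n \<le> r - 1" using n(2,3) n0 L r by (simp_all add: field_simps)
    hence "\<bar>adm_F q (m / n) - F\<^sub>1\<bar> \<le> L * \<bar>- \<delta> / n\<bar>" and mr: "m / n \<le> r"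
      unfolding mn using small L(3)[of "- \<delta> / n"] by (linarith | simp)+
    moreover have "L * \<bar>- \<delta> / n\<bar> \<le> L * (G / n)" using small L by (intro mult_left_mono) auto
    ultimately have F: "\<bar>adm_F q (m / n) - F\<^sub>1\<bar> \<le> L * G / n" by simp
    have "ereal (m / n) < radius" using mr r(2) by (meson ereal_less_eq(3) le_less_trans)
    hence dom: "\<delta>\<^sub>0 + d < sqrt s" "ereal ((sqrt s - (\<delta>\<^sub>0 + d)) / sqrt s) < radius"
      using m by (auto simp: m_def \<delta>_def n_def)
    define u w where "u = 1 / n" and "w = 1 / m"
    define X where "X = (u + \<bar>d\<bar>)\<^sup>2"
    have u0: "u > 0" "w > 0" "w \<le> 2 * u" using n0 m by (auto simp: u_def w_def field_simps)
    have X: "u\<^sup>2 \<le> X" "\<bar>d\<bar> * u \<le> X" "d\<^sup>2 \<le> X" 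
    proof -
      have "X = u\<^sup>2 + 2 * (\<bar>d\<bar> * u) + d\<^sup>2" by (simp add: X_def power2_sum)
      moreover have "0 \<le> \<bar>d\<bar> * u" using u0 by simp
      ultimately show "u\<^sup>2 \<le> X" "\<bar>d\<bar> * u \<le> X" "d\<^sup>2 \<le> X" 
        using zero_le_power2[of u] zero_le_power2[of d] by linarith+
    qed
    have wu: "\<bar>w - u\<bar> \<le> 2 * G * u\<^sup>2"
    proof -
      have "w - u = \<delta> * (w * u)" using n0 m(3) by (simp add: w_def u_def m_def field_simps)
      hence "\<bar>w - u\<bar> = \<bar>\<delta>\<bar> * (w * u)" using u0 by (simp add: abs_mult)
      also have "\<dots> \<le> G * (2 * u * u)" using \<delta> u0 by (intro mult_mono) auto
      finally show ?thesis by (simp add: power2_eq_square)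
    qed
    define Y F where "Y = inverse (erlang_B s (n * m)) / n" and "F = adm_F q (m / n)"
    have Y: "\<bar>Y - (M + (1 + \<delta>\<^sub>0 * M) * d + c\<^sub>0 * u)\<bar> \<le> (4 * C\<^sub>1 + C\<^sub>2 + 2 * C\<^sub>3 + 2 * \<bar>c\<^sub>0\<bar> * G) * X"
    proof -
      have "\<bar>Y - mills \<delta> - mills_corr \<delta> * w\<bar> \<le> C\<^sub>1 * w\<^sup>2"
        using C1(2)[OF ns m(1)] \<delta> by (simp add: m(4) Y_def w_def power_divide)
      also have "\<dots> \<le> C\<^sub>1 * (4 * X)"
      proof (rule mult_left_mono[OF _ C1(1)])
        have "w\<^sup>2 \<le> (2 * u)\<^sup>2" using u0 by (intro power_mono) auto
        thus "w\<^sup>2 \<le> 4 * X" using X by (simp add: power_mult_distrib)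
      qed
      finally have 1: "\<bar>Y - mills \<delta> - mills_corr \<delta> * w\<bar> \<le> 4 * C\<^sub>1 * X" by simp
      have "\<bar>mills \<delta> - M - (1 + \<delta>\<^sub>0 * M) * d\<bar> \<le> C\<^sub>2 * d\<^sup>2" unfolding \<delta>_def using C2(2) d \<rho> by simp
      also have "\<dots> \<le> C\<^sub>2 * X" using X C2(1) by (intro mult_left_mono)
      finally have 2: "\<bar>mills \<delta> - M - (1 + \<delta>\<^sub>0 * M) * d\<bar> \<le> C\<^sub>2 * X" .
      have "\<bar>(mills_corr \<delta> - c\<^sub>0) * w\<bar> \<le> (C\<^sub>3 * \<bar>d\<bar>) * (2 * u)"
        unfolding abs_mult using C3(1) C3(3)[of d] d u0 by (intro mult_mono) (auto simp: \<delta>_def \<rho>_def)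
      also have "\<dots> = 2 * C\<^sub>3 * (\<bar>d\<bar> * u)" by simp
      also have "\<dots> \<le> 2 * C\<^sub>3 * X" using X C3(1) by (intro mult_left_mono) auto
      finally have 3: "\<bar>(mills_corr \<delta> - c\<^sub>0) * w\<bar> \<le> 2 * C\<^sub>3 * X" .
      have "\<bar>c\<^sub>0 * (w - u)\<bar> \<le> \<bar>c\<^sub>0\<bar> * (2 * G * u\<^sup>2)" unfolding abs_mult using wu by (intro mult_left_mono) auto
      also have "\<dots> = 2 * \<bar>c\<^sub>0\<bar> * G * u\<^sup>2" by simp
      also have "\<dots> \<le> 2 * \<bar>c\<^sub>0\<bar> * G * X" using X G by (intro mult_left_mono) auto
      finally have 4: "\<bar>c\<^sub>0 * (w - u)\<bar> \<le> 2 * \<bar>c\<^sub>0\<bar> * G * X" .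
      have "Y - (M + (1 + \<delta>\<^sub>0 * M) * d + c\<^sub>0 * u) = (Y - mills \<delta> - mills_corr \<delta> * w) + 
          (mills \<delta> - M - (1 + \<delta>\<^sub>0 * M) * d) + (mills_corr \<delta> - c\<^sub>0) * w + c\<^sub>0 * (w - u)"
        by (simp add: algebra_simps)
      moreover have "(4 * C\<^sub>1 + C\<^sub>2 + 2 * C\<^sub>3 + 2 * \<bar>c\<^sub>0\<bar> * G) * X = 4 * C\<^sub>1 * X + C\<^sub>2 * X + 2 * C\<^sub>3 * X + 2 * \<bar>c\<^sub>0\<bar> * G * X"
        by (simp add: distrib_right)
      ultimately show ?thesis using 1 2 3 4 by linarith
    qed
    have F': "\<bar>F - F\<^sub>1\<bar> \<le> L * G * u" using F by (simp add: F_def u_def)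
    have Fu: "\<bar>F * u - F\<^sub>1 * u\<bar> \<le> L * G * X"
    proof -
      have "\<bar>F * u - F\<^sub>1 * u\<bar> = \<bar>F - F\<^sub>1\<bar> * u" using u0 by (simp add: abs_mult flip: left_diff_distrib)
      also have "\<dots> \<le> (L * G * u) * u" using F' u0 by (intro mult_right_mono) auto
      also have "\<dots> = L * G * u\<^sup>2" by (simp add: power2_eq_square)
      also have "\<dots> \<le> L * G * X" using X L G by (intro mult_left_mono) auto
      finally show ?thesis .
    qed
    have Fw: "\<bar>\<delta> * F * w - \<delta>\<^sub>0 * F\<^sub>1 * u\<bar> \<le> (2 * G * (L * G) + 2 * G\<^sup>2 * \<bar>F\<^sub>1\<bar> + \<bar>F\<^sub>1\<bar>) * X"
    proof -
      have "\<bar>\<delta> * (F - F\<^sub>1) * w\<bar> \<le> G * (L * G * u) * (2 * u)"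
        unfolding abs_mult using \<delta> F' u0 L G by (intro mult_mono) auto
      also have "\<dots> = 2 * G * (L * G) * u\<^sup>2" by (simp add: power2_eq_square)
      also have "\<dots> \<le> 2 * G * (L * G) * X" using X L G by (intro mult_left_mono) auto
      finally have 1: "\<bar>\<delta> * (F - F\<^sub>1) * w\<bar> \<le> 2 * G * (L * G) * X" .
      have "\<bar>\<delta> * F\<^sub>1 * (w - u)\<bar> \<le> G * \<bar>F\<^sub>1\<bar> * (2 * G * u\<^sup>2)"
        unfolding abs_mult using \<delta> wu G by (intro mult_mono) auto
      also have "\<dots> = 2 * G\<^sup>2 * \<bar>F\<^sub>1\<bar> * u\<^sup>2" by (simp add: power2_eq_square)
      also have "\<dots> \<le> 2 * G\<^sup>2 * \<bar>F\<^sub>1\<bar> * X" using X by (intro mult_left_mono) auto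
      finally have 2: "\<bar>\<delta> * F\<^sub>1 * (w - u)\<bar> \<le> 2 * G\<^sup>2 * \<bar>F\<^sub>1\<bar> * X" .
      have "\<bar>d * F\<^sub>1 * u\<bar> = \<bar>F\<^sub>1\<bar> * (\<bar>d\<bar> * u)" using u0 by (simp add: abs_mult)
      also have "\<dots> \<le> \<bar>F\<^sub>1\<bar> * X" using X by (intro mult_left_mono) auto
      finally have 3: "\<bar>d * F\<^sub>1 * u\<bar> \<le> \<bar>F\<^sub>1\<bar> * X" .
      have "\<delta> * F * w - \<delta>\<^sub>0 * F\<^sub>1 * u = \<delta> * (F - F\<^sub>1) * w + \<delta> * F\<^sub>1 * (w - u) + d * F\<^sub>1 * u"
        by (simp add: \<delta>_def algebra_simps)
      moreover have "(2 * G * (L * G) + 2 * G\<^sup>2 * \<bar>F\<^sub>1\<bar> + \<bar>F\<^sub>1\<bar>) * X = 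
          2 * G * (L * G) * X + 2 * G\<^sup>2 * \<bar>F\<^sub>1\<bar> * X + \<bar>F\<^sub>1\<bar> * X"
        by (simp only: distrib_right)
      ultimately show ?thesis using 1 2 3 by linarith
    qed
    define RY where "RY = Y - (M + (1 + \<delta>\<^sub>0 * M) * d + c\<^sub>0 * u)"
    define RF where "RF = F * u - F\<^sub>1 * u"
    define RW where "RW = \<delta> * F * w - \<delta>\<^sub>0 * F\<^sub>1 * u"
    have "blocking_defect \<epsilon> s \<delta> = \<epsilon> * (Y + F * u) - 1 + \<delta> * F * w"
      by (simp add: blocking_defect_def Let_def Y_def F_def u_def w_def n_def m_def)
    also have "\<dots> = (\<epsilon> * M - 1) + A * d + b * u + (\<epsilon> * (RY + RF) + RW)"
      by (simp add: RY_def RF_def RW_def A_def b_def M_def c\<^sub>0_def F\<^sub>1_def algebra_simps)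
    finally have "blocking_defect \<epsilon> s \<delta> - (A * d + b / n) = \<epsilon> * (RY + RF) + RW"
      using \<epsilon>M by (simp add: u_def)
    also have "\<bar>\<dots>\<bar> \<le> \<epsilon> * (\<bar>RY\<bar> + \<bar>RF\<bar>) + \<bar>RW\<bar>"
    proof -
      have "\<bar>\<epsilon> * (RY + RF)\<bar> \<le> \<epsilon> * (\<bar>RY\<bar> + \<bar>RF\<bar>)"
        unfolding abs_mult using \<epsilon> by (intro mult_mono) auto
      thus ?thesis by linarith
    qed
    also have "\<dots> \<le> \<epsilon> * ((4 * C\<^sub>1 + C\<^sub>2 + 2 * C\<^sub>3 + 2 * \<bar>c\<^sub>0\<bar> * G) * X + L * G * X) + 
        (2 * G * (L * G) + 2 * G\<^sup>2 * \<bar>F\<^sub>1\<bar> + \<bar>F\<^sub>1\<bar>) * X"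
      using Y Fu Fw \<epsilon> unfolding RY_def[symmetric] RF_def[symmetric] RW_def[symmetric]
      by (intro add_mono mult_left_mono) auto
    also have "\<dots> = C * X" by (simp add: C_def algebra_simps)
    finally show "\<delta>\<^sub>0 + d < sqrt s \<and> ereal ((sqrt s - (\<delta>\<^sub>0 + d)) / sqrt s) < radius \<and>
       \<bar>blocking_defect \<epsilon> s (\<delta>\<^sub>0 + d) - (A * d + b / sqrt s)\<bar> \<le> C * (1 / sqrt s + \<bar>d\<bar>)\<^sup>2"
      using dom by (simp add: X_def u_def n_def \<delta>_def)
  qed
  with \<rho> C that show ?thesis by blast
qed

lemma radius_gt_1:
  assumes "0 \<le> adm_P q" "adm_P q < 1"
  shows "1 < radius"
  using assms by (auto simp: fps_conv_radius_adm_fps one_ereal_def)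

text \<open>
  Between two points where the monotonic function \<open>D\<close> takes the same value it is constant, which
  \<open>D_R_not_constant\<close> excludes.
\<close>

lemma D_R_inj:
  assumes s: "s \<ge> 1"
    and mono: "let f = (\<lambda>\<gamma>. D_R q s (real s - \<gamma> * sqrt (real s)));
           S = {\<gamma>. gamma_P q s < ereal \<gamma> \<and> \<gamma> \<le> sqrt (real s)}
       in mono_on S f \<or> antimono_on S f"
    and c: "c \<noteq> 0" and P: "0 \<le> adm_P q"
    and \<mu>\<^sub>1: "0 < \<mu>\<^sub>1" "ereal \<mu>\<^sub>1 < lambda_P q s" "D_R q s \<mu>\<^sub>1 = c"
    and \<mu>\<^sub>2: "0 < \<mu>\<^sub>2" "ereal \<mu>\<^sub>2 < lambda_P q s" "D_R q s \<mu>\<^sub>2 = c"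
  shows "\<mu>\<^sub>1 = \<mu>\<^sub>2"
proof -
  define f where "f = (\<lambda>\<gamma>. D_R q s (real s - \<gamma> * sqrt (real s)))"
  define S where "S = {\<gamma>. gamma_P q s < ereal \<gamma> \<and> \<gamma> \<le> sqrt (real s)}"
  define n where "n = sqrt s"
  have n: "n > 0" "n * n = s" using s by (auto simp: n_def)
  define g where "g = (\<lambda>\<mu>::real. (s - \<mu>) / n)"
  have fg: "f (g \<mu>) = D_R q s \<mu>" for \<mu>
    using n by (simp add: f_def g_def flip: n_def)
  have gS: "g \<mu> \<in> S" if "0 < \<mu>" "ereal \<mu> < lambda_P q s" for \<mu>
  proof -
    have "g \<mu> \<le> n" using that n by (simp add: g_def field_simps)
    moreover have "gamma_P q s < ereal (g \<mu>)"
    proof (cases "adm_P q = 0")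
      case False
      hence p: "adm_P q > 0" using P by simp
      have "\<mu> < s / adm_P q" using that False by (simp add: lambda_P_def)
      hence "s - s / adm_P q < s - \<mu>" by simp
      moreover have "s - s / adm_P q = - ((1 - adm_P q) / adm_P q) * n * n"
        using p by (simp add: mult.assoc n(2) field_simps)
      ultimately have "- ((1 - adm_P q) / adm_P q) * n < g \<mu>"
        unfolding g_def using n(1) by (simp add: pos_less_divide_eq)
      thus ?thesis using False by (simp add: gamma_P_def n_def)
    qed (simp add: gamma_P_def)
    ultimately show ?thesis by (simp add: S_def n_def)
  qed
  have False if a: "0 < a" "a < b" "ereal b < lambda_P q s" "D_R q s a = c" "D_R q s b = c" for a b
  proof (rule D_R_not_constant[OF s a(1,2) _ c])
    show "ereal (b / s) < radius" using a(3) less_lambda_P_iff[OF s] by simp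
    fix \<mu> assume \<mu>: "a \<le> \<mu>" "\<mu> \<le> b"
    have S: "g a \<in> S" "g b \<in> S" "g \<mu> \<in> S"
      using a \<mu> by (auto intro!: gS intro: le_less_trans[of _ "ereal b"] less_trans[of _ "ereal b"])
    have le: "g b \<le> g \<mu>" "g \<mu> \<le> g a" using \<mu> n by (auto simp: g_def divide_right_mono)
    from mono have "mono_on S f \<or> antimono_on S f" by (simp add: Let_def S_def f_def)
    hence "f (g \<mu>) \<le> c \<and> c \<le> f (g \<mu>)"
    proof
      assume "mono_on S f"
      from mono_onD[OF this S(2,3) le(1)] mono_onD[OF this S(3,1) le(2)] show ?thesis
        using a by (simp add: fg)
    next
      assume "antimono_on S f"
      from monotone_onD[OF this S(2,3) le(1)] monotone_onD[OF this S(3,1) le(2)] show ?thesis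
        using a by (simp add: fg)
    qed
    thus "D_R q s \<mu> = c" by (simp add: fg)
  qed
  from this[of \<mu>\<^sub>1 \<mu>\<^sub>2] this[of \<mu>\<^sub>2 \<mu>\<^sub>1] show ?thesis
    using \<mu>\<^sub>1 \<mu>\<^sub>2 by (cases \<mu>\<^sub>1 \<mu>\<^sub>2 rule: linorder_cases) auto
qed

text \<open>
  Both directions of the change of variables \<open>\<gamma> = \<delta> + \<epsilon> - \<delta> \<epsilon> / \<surd>s\<close>. That \<open>\<gamma>\<close> lies in \<open>(0, \<surd>s)\<close> amounts to
  \<open>0 < \<lambda> < s\<close>, which the bounds on the throughput provide.
\<close>

lemma is_gamma_R_from_blocking:
  assumes s: "s \<ge> 1"
    and mono: "let f = (\<lambda>\<gamma>. D_R q s (real s - \<gamma> * sqrt (real s)));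
           S = {\<gamma>. gamma_P q s < ereal \<gamma> \<and> \<gamma> \<le> sqrt (real s)}
       in mono_on S f \<or> antimono_on S f"
    and \<epsilon>: "0 < \<epsilon>" and P: "0 \<le> adm_P q"
    and \<delta>: "\<delta> < sqrt s" "ereal ((sqrt s - \<delta>) / sqrt s) < radius"
    and D: "sqrt s * D_R q s (sqrt s * (sqrt s - \<delta>)) = \<epsilon>"
  defines "\<gamma> \<equiv> \<delta> + \<epsilon> - \<delta> * \<epsilon> / sqrt s"
  shows "is_gamma_R q \<epsilon> s \<gamma>" "is_gamma_R q \<epsilon> s \<gamma>' \<Longrightarrow> \<gamma>' = \<gamma>"
proof -
  define n \<mu> where "n = sqrt s" and "\<mu> = n * (n - \<delta>)"
  have n: "n > 0" "n * n = s" using s by (auto simp: n_def)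
  have \<mu>0: "\<mu> > 0" using n \<delta> by (simp add: \<mu>_def n_def)
  have "\<mu> / s = (n - \<delta>) / n" unfolding n(2)[symmetric] \<mu>_def using n(1) by simp
  hence rad: "ereal (\<mu> / s) < radius" using \<delta>(2) by (simp add: n_def)
  have \<mu>P: "ereal \<mu> < lambda_P q s" using rad less_lambda_P_iff[OF s] by simp
  have D\<mu>: "D_R q s \<mu> = \<epsilon> / n" using D n(1) by (simp add: \<mu>_def n_def field_simps)
  have l: "s - \<gamma> * n = \<mu> * (1 - D_R q s \<mu>)"
    unfolding D\<mu> using n(1) by (simp add: \<gamma>_def \<mu>_def n(2)[symmetric] field_simps flip: n_def)
  have solves: "solves_Omega q s (s - \<gamma> * n) (\<mu> * D_R q s \<mu>)"
    unfolding solves_Omega_def l using \<mu>0 \<mu>P by (simp add: algebra_simps)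
  hence ex1: "\<exists>!\<Omega>. solves_Omega q s (s - \<gamma> * n) \<Omega>"
    using solves_Omega_unique[OF s] by blast
  hence "Omega_R q s (s - \<gamma> * n) = \<mu> * D_R q s \<mu>"
    unfolding Omega_R_def using solves by (rule the1_equality)
  hence "s - \<gamma> * n + Omega_R q s (s - \<gamma> * n) = \<mu>"
    unfolding l by (simp add: algebra_simps)
  moreover have "0 < \<gamma> * n" "\<gamma> * n < n * n"
    using throughput_bounds[OF \<mu>0 rad s] l n(2) by linarith+
  hence "0 < \<gamma>" "\<gamma> < n" using n(1) by (auto simp: zero_less_mult_iff)
  ultimately show "is_gamma_R q \<epsilon> s \<gamma>"
    using ex1 D\<mu> n(1) by (simp add: is_gamma_R_def Let_def flip: n_def)
  show "\<gamma>' = \<gamma>" if "is_gamma_R q \<epsilon> s \<gamma>'"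
  proof -
    define l' where "l' = s - \<gamma>' * n"
    define \<mu>' where "\<mu>' = l' + Omega_R q s l'"
    from that have ex: "\<exists>!\<Omega>. solves_Omega q s l' \<Omega>" and D': "n * D_R q s \<mu>' = \<epsilon>"
      by (auto simp: is_gamma_R_def Let_def \<mu>'_def l'_def n_def)
    from theI'[OF ex] have sol: "solves_Omega q s l' (Omega_R q s l')" by (simp add: Omega_R_def)
    have D\<mu>': "D_R q s \<mu>' = \<epsilon> / n" using D' n(1) by (simp add: field_simps)
    have "\<mu>' = \<mu>"
      by (rule D_R_inj[OF s mono _ P, of "\<epsilon> / n"])
         (use sol \<mu>0 \<mu>P D\<mu> D\<mu>' \<epsilon> n(1) in \<open>auto simp: solves_Omega_def \<mu>'_def\<close>)
    moreover have "l' = \<mu>' * (1 - D_R q s \<mu>')"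
      using sol by (simp add: solves_Omega_def \<mu>'_def algebra_simps)
    ultimately have "\<gamma>' * n = \<gamma> * n" using l unfolding l'_def by (simp only:)
    thus ?thesis using n(1) by simp
  qed
qed

text \<open>
  Here \<open>g\<^sub>\<infinity> \<delta>\<^sub>0 = \<epsilon>\<close>, and in the quotient of \<open>h\<close> and \<open>g\<^sub>\<infinity>'\<close> a common factor \<open>- \<epsilon>\<close> cancels.
\<close>

lemma theta_inf_R_eq:
  assumes \<epsilon>: "0 < \<epsilon>"
  defines "\<delta>\<^sub>0 \<equiv> delta_inf \<epsilon>"
  shows "theta_inf_R q \<epsilon> = - \<delta>\<^sub>0 * \<epsilon> - 
    (\<epsilon> * mills_corr \<delta>\<^sub>0 + (\<epsilon> + \<delta>\<^sub>0) * adm_F q 1) / (\<epsilon> * (1 + \<delta>\<^sub>0 * mills \<delta>\<^sub>0))"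
proof -
  have M: "mills \<delta>\<^sub>0 = 1 / \<epsilon>" using mills_delta_inf[OF \<epsilon>] by (simp add: \<delta>\<^sub>0_def)
  have g: "g_inf \<delta>\<^sub>0 = \<epsilon>" by (simp add: g_inf_eq M)
  have pos: "1 + \<delta>\<^sub>0 * mills \<delta>\<^sub>0 > 0" by (rule mills_deriv_pos)
  hence ed: "\<epsilon> + \<delta>\<^sub>0 > 0" using \<epsilon> by (simp add: M field_simps)
  have h: "h_inf_R q \<delta>\<^sub>0 = - (\<epsilon> * (\<epsilon> * mills_corr \<delta>\<^sub>0 + (\<epsilon> + \<delta>\<^sub>0) * adm_F q 1))"
    using \<epsilon> by (simp add: h_inf_R_def h_inf_def g mills_corr_def M field_simps power2_eq_square)
  have g': "deriv g_inf \<delta>\<^sub>0 = - (\<epsilon> * (\<epsilon> + \<delta>\<^sub>0))"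
    using \<epsilon> by (simp add: deriv_g_inf M field_simps power2_eq_square)
  have "\<epsilon> * (1 + \<delta>\<^sub>0 * mills \<delta>\<^sub>0) = \<epsilon> + \<delta>\<^sub>0" using \<epsilon> by (simp add: M field_simps)
  thus ?thesis
    unfolding theta_inf_R_def \<delta>\<^sub>0_def[symmetric] h g' using \<epsilon> by simp
qed

end

theorem theorem8:
  fixes q :: "nat \<Rightarrow> real" and \<epsilon> :: real
  assumes q_range: "\<And>n. 0 \<le> q n \<and> q n \<le> 1"
    and P_range: "0 \<le> adm_P q" "adm_P q < 1"
    and F_lim: "F_diverges q"
    and D_mono: "\<And>s::nat. s \<ge> 1 \<Longrightarrow>
      (let f = (\<lambda>\<gamma>. D_R q s (real s - \<gamma> * sqrt (real s)));
           S = {\<gamma>. gamma_P q s < ereal \<gamma> \<and> \<gamma> \<le> sqrt (real s)}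
       in mono_on S f \<or> antimono_on S f)"
    and eps: "\<epsilon> > 0"
  shows "(\<forall>\<^sub>F s in sequentially. \<exists>!\<gamma>. is_gamma_R q \<epsilon> s \<gamma>) \<and>
    (\<lambda>s. gamma_R q \<epsilon> s - (\<epsilon> + delta_inf \<epsilon> + theta_inf_R q \<epsilon> / sqrt (real s)))
      \<in> O(\<lambda>s. 1 / real s)"
proof -
  interpret admission_policy q by unfold_locales (rule q_range)
  define \<delta>\<^sub>0 where "\<delta>\<^sub>0 = delta_inf \<epsilon>"
  define A where "A = \<epsilon> * (1 + \<delta>\<^sub>0 * mills \<delta>\<^sub>0)"
  define b where "b = \<epsilon> * mills_corr \<delta>\<^sub>0 + (\<epsilon> + \<delta>\<^sub>0) * adm_F q 1"
  have A: "A > 0" using eps mills_deriv_pos[of \<delta>\<^sub>0] by (simp add: A_def)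
  have n: "filterlim (\<lambda>s. sqrt (real s)) at_top sequentially"
    by (rule filterlim_compose[OF sqrt_at_top filterlim_real_sequentially])
  obtain \<rho> C where \<rho>: "0 < \<rho>" and C: "0 \<le> C"
    and ev: "\<forall>\<^sub>F s in sequentially. \<forall>d. \<bar>d\<bar> \<le> \<rho> \<longrightarrow> 
       \<delta>\<^sub>0 + d < sqrt s \<and> ereal ((sqrt s - (\<delta>\<^sub>0 + d)) / sqrt s) < radius \<and>
       \<bar>blocking_defect \<epsilon> s (\<delta>\<^sub>0 + d) - (A * d + b / sqrt s)\<bar> \<le> C * (1 / sqrt s + \<bar>d\<bar>)\<^sup>2"
    using blocking_defect_expansion[OF eps radius_gt_1[OF P_range]]
    unfolding A_def b_def \<delta>\<^sub>0_def by blast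
  have ev1: "\<forall>\<^sub>F s :: nat in sequentially. s \<ge> 1" by (rule eventually_ge_at_top)
  have approx: "\<forall>\<^sub>F s in sequentially. \<forall>d. \<bar>d\<bar> \<le> \<rho> \<longrightarrow> 
       \<bar>blocking_defect \<epsilon> s (\<delta>\<^sub>0 + d) - (A * d + b / sqrt s)\<bar> \<le> C * (1 / sqrt s + \<bar>d\<bar>)\<^sup>2"
    using ev by eventually_elim blast
  have dom: "\<forall>\<^sub>F s in sequentially. \<forall>\<delta>. \<bar>\<delta> - \<delta>\<^sub>0\<bar> \<le> \<rho> \<longrightarrow> 
       \<delta> < sqrt s \<and> ereal ((sqrt s - \<delta>) / sqrt s) < radius"
  proof (use ev in eventually_elim, intro allI impI)
    fix s :: nat and \<delta> assume "\<forall>d. \<bar>d\<bar> \<le> \<rho> \<longrightarrow> 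
       \<delta>\<^sub>0 + d < sqrt s \<and> ereal ((sqrt s - (\<delta>\<^sub>0 + d)) / sqrt s) < radius \<and>
       \<bar>blocking_defect \<epsilon> s (\<delta>\<^sub>0 + d) - (A * d + b / sqrt s)\<bar> \<le> C * (1 / sqrt s + \<bar>d\<bar>)\<^sup>2"
      and "\<bar>\<delta> - \<delta>\<^sub>0\<bar> \<le> \<rho>"
    from this(1)[rule_format, OF this(2)] show "\<delta> < sqrt s \<and> ereal ((sqrt s - \<delta>) / sqrt s) < radius"
      by simp
  qed
  have cont: "\<forall>\<^sub>F s in sequentially. continuous_on {\<delta>\<^sub>0 - \<rho>..\<delta>\<^sub>0 + \<rho>} (blocking_defect \<epsilon> s)"
    using dom ev1 by eventually_elim (intro blocking_defect_continuous_on, auto simp: abs_le_iff)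
  obtain K where K: "K \<ge> 0" and root: "\<forall>\<^sub>F s in sequentially. \<exists>\<delta>. \<bar>\<delta> - \<delta>\<^sub>0\<bar> \<le> \<rho> \<and> 
      \<bar>\<delta> - \<delta>\<^sub>0 + b / (A * sqrt s)\<bar> \<le> K / (sqrt s)\<^sup>2 \<and> blocking_defect \<epsilon> s \<delta> = 0"
    using perturbed_linear_root[OF n A C \<rho> approx cont] by blast
  define \<kappa> where "\<kappa> = b / A"
  define B where "B = K + \<epsilon> * (\<bar>\<kappa>\<bar> + K)"
  have key: "\<forall>\<^sub>F s in sequentially. (\<exists>!\<gamma>. is_gamma_R q \<epsilon> s \<gamma>) \<and> 
     norm (gamma_R q \<epsilon> s - (\<epsilon> + delta_inf \<epsilon> + theta_inf_R q \<epsilon> / sqrt (real s))) \<le> B * norm (1 / real s)"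
    using root dom ev1
  proof eventually_elim
    case (elim s)
    then obtain \<delta> where \<delta>: "\<bar>\<delta> - \<delta>\<^sub>0\<bar> \<le> \<rho>" "\<bar>\<delta> - \<delta>\<^sub>0 + b / (A * sqrt s)\<bar> \<le> K / (sqrt s)\<^sup>2" 
      "blocking_defect \<epsilon> s \<delta> = 0" by blast
    have s: "s \<ge> 1" by fact
    have dom: "\<delta> < sqrt s" "ereal ((sqrt s - \<delta>) / sqrt s) < radius" using elim(2) \<delta>(1) by auto
    define n where "n = sqrt s"
    have n: "n \<ge> 1" "n\<^sup>2 = s" using s by (auto simp: n_def)
    define \<gamma> where "\<gamma> = \<delta> + \<epsilon> - \<delta> * \<epsilon> / n"
    have "sqrt s * D_R q s (sqrt s * (sqrt s - \<delta>)) = \<epsilon>"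
      using blocking_defect_eq_0_iff[OF s dom] \<delta>(3) by blast
    note \<gamma> = is_gamma_R_from_blocking[OF s D_mono[OF s] eps P_range(1) dom this, folded n_def, folded \<gamma>_def]
    have ex1: "\<exists>!\<gamma>. is_gamma_R q \<epsilon> s \<gamma>" using \<gamma> by blast
    have gR: "gamma_R q \<epsilon> s = \<gamma>"
      unfolding gamma_R_def using ex1 \<gamma>(1) by (rule the1_equality)
    have th: "theta_inf_R q \<epsilon> = - \<delta>\<^sub>0 * \<epsilon> - \<kappa>"
      using theta_inf_R_eq[OF eps] by (simp add: \<kappa>_def A_def b_def \<delta>\<^sub>0_def)
    have "gamma_R q \<epsilon> s - (\<epsilon> + delta_inf \<epsilon> + theta_inf_R q \<epsilon> / n) = 
        (\<delta> - \<delta>\<^sub>0 + \<kappa> / n) - \<epsilon> * ((\<delta> - \<delta>\<^sub>0) / n)"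
      unfolding gR th \<gamma>_def \<delta>\<^sub>0_def[symmetric]
      by (simp add: add_divide_distrib diff_divide_distrib algebra_simps)
    moreover have E: "\<bar>\<delta> - \<delta>\<^sub>0 + \<kappa> / n\<bar> \<le> K / n\<^sup>2"
      using \<delta>(2) by (simp add: \<kappa>_def n_def)
    moreover have "\<bar>\<epsilon> * ((\<delta> - \<delta>\<^sub>0) / n)\<bar> \<le> \<epsilon> * ((\<bar>\<kappa>\<bar> + K) / n\<^sup>2)"
    proof -
      have "K / n\<^sup>2 \<le> K / n"
        using n(1) K self_le_power[of n 2] by (intro divide_left_mono mult_pos_pos) auto
      moreover have "\<bar>\<kappa> / n\<bar> = \<bar>\<kappa>\<bar> / n" using n by simp
      ultimately have D: "\<bar>\<delta> - \<delta>\<^sub>0\<bar> \<le> (\<bar>\<kappa>\<bar> + K) / n"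
        using E unfolding add_divide_distrib by linarith
      moreover have "\<bar>(\<delta> - \<delta>\<^sub>0) / n\<bar> = \<bar>\<delta> - \<delta>\<^sub>0\<bar> / n" using n(1) by simp
      ultimately have "\<bar>(\<delta> - \<delta>\<^sub>0) / n\<bar> \<le> (\<bar>\<kappa>\<bar> + K) / n / n"
        using divide_right_mono[OF D, of n] n(1) by linarith
      hence le: "\<bar>(\<delta> - \<delta>\<^sub>0) / n\<bar> \<le> (\<bar>\<kappa>\<bar> + K) / n\<^sup>2"
        by (simp only: divide_divide_eq_left power2_eq_square)
      have "\<bar>\<epsilon> * z\<bar> = \<epsilon> * \<bar>z\<bar>" for z using eps by (simp add: abs_mult)
      thus ?thesis using mult_left_mono[OF le, of \<epsilon>] eps by (simp only: less_imp_le)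
    qed
    ultimately have "\<bar>gamma_R q \<epsilon> s - (\<epsilon> + delta_inf \<epsilon> + theta_inf_R q \<epsilon> / n)\<bar> \<le> 
        K / n\<^sup>2 + \<epsilon> * ((\<bar>\<kappa>\<bar> + K) / n\<^sup>2)"
      by linarith
    also have "\<dots> = B * norm (1 / real s)"
      using n by (simp add: B_def distrib_left add_divide_distrib)
    finally show ?case using ex1 by (simp add: n_def)
  qed
  show ?thesis
  proof
    show "\<forall>\<^sub>F s in sequentially. \<exists>!\<gamma>. is_gamma_R q \<epsilon> s \<gamma>"
      using key by eventually_elim blast
    show "(\<lambda>s. gamma_R q \<epsilon> s - (\<epsilon> + delta_inf \<epsilon> + theta_inf_R q \<epsilon> / sqrt (real s))) \<in> O(\<lambda>s. 1 / real s)"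
      by (rule bigoI[of _ B]) (use key in \<open>eventually_elim, blast\<close>)
  qed
qed

end
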